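(* Let $\psi:\mathbb R\to\mathbb R$ be a non-decreasing function such that $-\log(1-x+x^2/2)\leq \psi(x)\leq \log(1+x+x^2/2)$ for all $x\in\mathbb R$. Let $Y_1,\ldots,Y_n\in \mathbb C^{d\times d}$ be independent self-adjoint random matrices whose entries have finite second moments, with $\sum_{j=1}^n\mathbb EY_j^2\neq 0$, and let $\sigma_n^2\geq\big\| \sum_{j=1}^n \mathbb EY_j^2 \big\|$. Define the effective dimension \[ \bar d:=\frac{\mathrm{tr} \left( \sum_{j=1}^n \mathbb EY_j^2\right) }{\left\| \sum_{j=1}^n \mathbb EY_j^2 \right\|}. \] Then for all $\theta>0$ and $t>0$, \[ \Pr\Big( \Big\| \sum_{j=1}^n \Big(\frac{1}{\theta}\psi( \theta Y_j ) - \mathbb EY_j \Big) \Big\| \geq t\sqrt n \Big) \leq 2 \bar d \Big( 1 + \frac{1}{\theta t \sqrt n} \Big) \exp\Big( -\theta t\sqrt{n} + \frac{\theta^2\sigma_n^2}{2} \Big). \]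
   Context: $\|\cdot\|$ is the operator norm. For a real function $f$ and a self-adjoint matrix $A=U\,\mathrm{diag}(\lambda_1,\ldots,\lambda_d)\,U^\ast$, $f(A):=U\,\mathrm{diag}(f(\lambda_1),\ldots,f(\lambda_d))\,U^\ast$. Expectations of random matrices are taken entrywise. *)

theory Defs
  imports "HOL-Analysis.Analysis" "HOL-Probability.Probability"
begin

definition adjoint_mat :: "complex^'d^'d \<Rightarrow> complex^'d^'d" where
  "adjoint_mat A = (\<chi> i j. cnj (A $ j $ i))"

definition self_adjoint :: "complex^'d^'d \<Rightarrow> bool" where
  "self_adjoint A \<longleftrightarrow> adjoint_mat A = A"

definition unitary_mat :: "complex^'d^'d \<Rightarrow> bool" where
  "unitary_mat U \<longleftrightarrow> U ** adjoint_mat U = mat 1 \<and> adjoint_mat U ** U = mat 1"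

definition diag_mat :: "('d \<Rightarrow> real) \<Rightarrow> complex^'d^'d" where
  "diag_mat l = (\<chi> i j. if i = j then complex_of_real (l i) else 0)"

text \<open>Functional calculus: f(A) = U diag(f(lambda_i)) U^* for a spectral decomposition
  A = U diag(lambda_i) U^* (independent of the chosen decomposition for self-adjoint A).\<close>
definition mat_fun :: "(real \<Rightarrow> real) \<Rightarrow> complex^'d^'d \<Rightarrow> complex^'d^'d" where
  "mat_fun f A = (SOME B. \<exists>U l. unitary_mat U \<and> A = U ** diag_mat l ** adjoint_mat U
                            \<and> B = U ** diag_mat (f \<circ> l) ** adjoint_mat U)"

definition op_norm :: "complex^'d^'d \<Rightarrow> real" where
  "op_norm A = onorm (\<lambda>x. A *v x)"

definition mat_expectation :: "'a measure \<Rightarrow> ('a \<Rightarrow> complex^'d^'d) \<Rightarrow> complex^'d^'d" where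
  "mat_expectation M Y = (\<chi> i j. integral\<^sup>L M (\<lambda>\<omega>. Y \<omega> $ i $ j))"

end

theory Submission
  imports Defs
begin

text \<open>Let \<open>s = \<theta> t \<surd>n\<close> and let \<open>Z\<close> be the sum of \<open>\<psi>(\<theta> Y\<^sub>j) - \<theta> E Y\<^sub>j\<close>. The bounds on \<open>\<psi>\<close> dominate \<open>Z\<close> and
  \<open>-Z\<close> by sums of \<open>log (1 \<plusminus> \<theta> Y\<^sub>j + \<theta>\<^sup>2 Y\<^sub>j\<^sup>2 / 2) \<minusplus> \<theta> E Y\<^sub>j\<close>, and Lieb's concavity theorem bounds the expected
  trace exponential of both by \<open>tr exp (\<theta>\<^sup>2 V / 2)\<close> with \<open>V\<close> the sum of \<open>E Y\<^sub>j\<^sup>2\<close>. Because \<open>tr (e\<^sup>Z - 1)\<close> can be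
  negative, Markov's inequality is applied to \<open>tr (cosh Z - 1)\<close> instead, which treats both tails
  at once; what this loses is absorbed by the factor \<open>1 + 1 / s\<close> whenever the claimed bound is
  below one. The functions that majorize \<open>Z\<close> are continuous in \<open>Y\<^sub>j\<close>, so measurability of \<open>\<psi>(\<theta> Y\<^sub>j)\<close> is not needed;
  if the event itself is not measurable, its \<^const>\<open>measure\<close> is zero.

  Lieb's theorem is obtained from the joint convexity of the relative entropy, which is an
  integral over \<open>s \<in> [0, 1]\<close> of suprema of functions linear in both arguments.\<close>

subsection \<open>Adjoints and quadratic forms\<close>

lemma adjoint_mat_nth [simp]: "adjoint_mat A $ i $ j = cnj (A $ j $ i)"
  by (simp add: adjoint_mat_def)

lemma adjoint_mat_adjoint [simp]: "adjoint_mat (adjoint_mat A) = A"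
  by (simp add: vec_eq_iff)

lemma adjoint_mat_mult: "adjoint_mat (A ** B) = adjoint_mat B ** adjoint_mat A"
  by (simp add: vec_eq_iff matrix_matrix_mult_def mult.commute)

lemma adjoint_mat_add: "adjoint_mat (A + B) = adjoint_mat A + adjoint_mat B"
  by (simp add: vec_eq_iff)

lemma adjoint_mat_diff: "adjoint_mat (A - B) = adjoint_mat A - adjoint_mat B"
  by (simp add: vec_eq_iff)

lemma adjoint_mat_scaleR: "adjoint_mat (c *\<^sub>R A) = c *\<^sub>R adjoint_mat A"
  by (simp add: vec_eq_iff)

lemma adjoint_mat_diag [simp]: "adjoint_mat (diag_mat l) = diag_mat l"
  by (simp add: vec_eq_iff diag_mat_def)

lemma self_adjoint_nth: "self_adjoint A \<Longrightarrow> cnj (A $ j $ i) = A $ i $ j"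
  by (metis adjoint_mat_nth self_adjoint_def)

lemma self_adjoint_add: "self_adjoint A \<Longrightarrow> self_adjoint B \<Longrightarrow> self_adjoint (A + B)"
  by (simp add: self_adjoint_def adjoint_mat_add)

lemma self_adjoint_diff: "self_adjoint A \<Longrightarrow> self_adjoint B \<Longrightarrow> self_adjoint (A - B)"
  by (simp add: self_adjoint_def adjoint_mat_diff)

lemma self_adjoint_scaleR: "self_adjoint A \<Longrightarrow> self_adjoint (c *\<^sub>R A)"
  by (simp add: self_adjoint_def adjoint_mat_scaleR)

lemma self_adjoint_0: "self_adjoint 0"
  by (simp add: self_adjoint_def vec_eq_iff)

lemma self_adjoint_sum: "(\<And>i. i \<in> I \<Longrightarrow> self_adjoint (A i)) \<Longrightarrow> self_adjoint (sum A I)"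
  by (induction I rule: infinite_finite_induct) (auto simp: self_adjoint_0 self_adjoint_add)

text \<open>The inner product \<open>\<bullet>\<close> on \<open>complex^'d\<close> is the real one,
  the real part of the Hermitian form. For self-adjoint \<open>A\<close> the Hermitian form of
  \<open>A\<close> takes real values, so \<open>x \<bullet> (A *v x)\<close> is exactly that
  form.\<close>

lemma inner_complex_vec: "(x::complex^'d) \<bullet> y = Re (\<Sum>i\<in>UNIV. cnj (x $ i) * y $ i)"
  by (simp add: inner_vec_def inner_complex_def)

lemma inner_matrix_vector: "x \<bullet> (A *v y) = (adjoint_mat A *v x) \<bullet> (y::complex^'d)"
proof -
  have "(\<Sum>i\<in>UNIV. cnj (x $ i) * (\<Sum>j\<in>UNIV. A $ i $ j * y $ j))
      = (\<Sum>i\<in>UNIV. \<Sum>j\<in>UNIV. cnj (x $ i) * A $ i $ j * y $ j)"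
    by (simp add: sum_distrib_left mult.assoc)
  also have "\<dots> = (\<Sum>j\<in>UNIV. \<Sum>i\<in>UNIV. cnj (x $ i) * A $ i $ j * y $ j)"
    by (rule sum.swap)
  also have "\<dots> = (\<Sum>j\<in>UNIV. cnj (\<Sum>i\<in>UNIV. cnj (A $ i $ j) * x $ i) * y $ j)"
    by (simp add: sum_distrib_left mult_ac)
  finally show ?thesis
    by (simp add: inner_complex_vec matrix_vector_mult_def)
qed

lemma inner_self_adjoint: "self_adjoint A \<Longrightarrow> x \<bullet> (A *v y) = (A *v x) \<bullet> (y::complex^'d)"
  by (simp add: inner_matrix_vector self_adjoint_def)

lemma trace_scaleR: "trace (c *\<^sub>R (A::complex^'d^'d)) = c *\<^sub>R trace A"
  by (simp add: trace_def scaleR_right.sum)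

lemma matrix_mult_diff_right: "C ** (A - B) = C ** A - C ** (B::complex^'d^'d)"
  by (simp add: vec_eq_iff matrix_matrix_mult_def sum_subtractf right_diff_distrib)

lemma matrix_mult_scaleR_right: "A ** (c *\<^sub>R B) = c *\<^sub>R (A ** (B::complex^'d^'d))"
  by (simp add: matrix_scalar_ac scalar_matrix_assoc)

lemma matrix_vector_scaleR: "(A::complex^'d^'d) *v (c *\<^sub>R x) = c *\<^sub>R (A *v x)"
  by (rule linear_cmul[OF matrix_vector_mul_linear])

lemma vector_smult_scaleR: "c *s (r *\<^sub>R x) = r *\<^sub>R (c *s (x::complex^'d))"
  by (simp add: vec_eq_iff)

subsection \<open>Spectral theorem\<close>

text \<open>A maximizer \<open>x\<close> of the quadratic form on the unit sphere of
  \<open>W\<close> is an eigenvector: the residual \<open>A *v x - l *\<^sub>R x\<close> lies in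
  \<open>W\<close>, and if it were nonzero, a small move of \<open>x\<close> along it would raise
  the Rayleigh quotient.\<close>

lemma ex_eigenvector_in_invariant_subspace:
  fixes A :: "complex^'d^'d"
  assumes A: "self_adjoint A" and W: "subspace W" "\<And>x. x \<in> W \<Longrightarrow> A *v x \<in> W" and ne: "w \<in> W" "w \<noteq> 0"
  shows "\<exists>x\<in>W. \<exists>l::real. norm x = 1 \<and> A *v x = l *\<^sub>R x"
proof -
  let ?f = "\<lambda>x. x \<bullet> (A *v x)"
  have "compact (W \<inter> sphere 0 1)"
    by (intro closed_Int_compact closed_subspace W) simp
  moreover have "(1 / norm w) *\<^sub>R w \<in> W \<inter> sphere 0 1"
    using ne W by (simp add: subspace_scale)
  moreover have "continuous_on (W \<inter> sphere 0 1) ?f"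
    by (intro continuous_intros linear_continuous_on matrix_vector_mul_bounded_linear)
  ultimately obtain x where x: "x \<in> W" "norm x = 1"
    and max: "\<And>y. y \<in> W \<Longrightarrow> norm y = 1 \<Longrightarrow> ?f y \<le> ?f x"
    using continuous_attains_sup[of "W \<inter> sphere 0 1" ?f] by force
  define l where "l = ?f x"
  have le: "?f y \<le> l * (y \<bullet> y)" if "y \<in> W" for y
  proof (cases "y = 0")
    case False
    have "?f ((1 / norm y) *\<^sub>R y) \<le> l"
      unfolding l_def using False that W by (intro max) (auto simp: subspace_scale)
    then show ?thesis
      using False by (simp add: matrix_vector_scaleR dot_square_norm power2_eq_square field_simps)
  qed simp
  define z where "z = A *v x - l *\<^sub>R x"
  have zW: "z \<in> W"
    unfolding z_def using W x by (intro subspace_diff subspace_scale) auto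
  define K where "K = l * (z \<bullet> z) - ?f z"
  \<comment> \<open>Maximality of \<open>x\<close> against \<open>x + e *\<^sub>R z\<close>,
    expanded in \<open>e\<close>: the constant terms cancel, and a first-order term is bounded by a
    second-order one.\<close>
  have 1: "2 * e * (z \<bullet> z) \<le> e\<^sup>2 * K" for e
  proof -
    have "?f (x + e *\<^sub>R z) \<le> l * ((x + e *\<^sub>R z) \<bullet> (x + e *\<^sub>R z))"
      by (intro le subspace_add subspace_scale W x zW)
    moreover have "?f (x + e *\<^sub>R z) = l + 2 * e * (z \<bullet> (A *v x)) + e\<^sup>2 * ?f z"
      by (simp add: l_def matrix_vector_right_distrib matrix_vector_scaleR inner_add_left
          inner_add_right inner_self_adjoint[OF A, of x z] inner_commute power2_eq_square ring_distribs)
    moreover have "(x + e *\<^sub>R z) \<bullet> (x + e *\<^sub>R z) = 1 + 2 * e * (z \<bullet> x) + e\<^sup>2 * (z \<bullet> z)"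
      using x(2) by (simp add: inner_add_left inner_add_right inner_commute[of x z]
          power2_eq_square ring_distribs norm_eq_1)
    ultimately have "l + 2 * e * (z \<bullet> (A *v x)) + e\<^sup>2 * ?f z \<le> l * (1 + 2 * e * (z \<bullet> x) + e\<^sup>2 * (z \<bullet> z))"
      by (simp only:)
    moreover have "2 * e * (z \<bullet> (A *v x)) = 2 * e * (z \<bullet> z) + 2 * e * (l * (z \<bullet> x))"
      unfolding z_def by (simp add: inner_diff_right ring_distribs)
    ultimately show ?thesis
      unfolding K_def by (simp only: ring_distribs mult_ac)
  qed
  have "z \<bullet> z \<le> 0"
  proof (rule ccontr)
    assume "\<not> z \<bullet> z \<le> 0"
    moreover define q where "q = z \<bullet> z"
    ultimately have p: "q > 0" by linarith
    have "K > 0"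
      using 1[of 1] p unfolding q_def[symmetric] by simp
    \<comment> \<open>The choice \<open>e = q / K\<close> turns the inequality into
      \<open>2 * q\<^sup>2 / K \<le> q\<^sup>2 / K\<close>.\<close>
    with 1[of "q / K"] p show False
      unfolding q_def[symmetric] by (simp add: field_simps power2_eq_square)
  qed
  then have "z = 0"
    by (metis inner_ge_zero inner_eq_zero_iff order_antisym)
  then show ?thesis
    using x unfolding z_def by auto
qed

text \<open>Induction on the set of indices. The next eigenvector is sought in the orthogonal
  complement of the previous ones, which is invariant because \<open>A\<close> is self-adjoint, and
  nonzero because at most \<open>2 * card S\<close> real constraints are fewer than the real
  dimension \<open>2 * CARD('d)\<close>.\<close>

lemma orthonormal_eigenvectors:
  fixes A :: "complex^'d^'d"
  assumes A: "self_adjoint A" and "finite S"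
  shows "\<exists>(u::'d \<Rightarrow> complex^'d) l::'d \<Rightarrow> real. \<forall>i\<in>S. A *v u i = l i *\<^sub>R u i \<and>
    (\<forall>j\<in>S. (\<Sum>k\<in>UNIV. cnj (u i $ k) * u j $ k) = (if i = j then 1 else 0))"
  using \<open>finite S\<close>
proof (induction S rule: finite_induct)
  case (insert a S)
  then obtain u :: "'d \<Rightarrow> complex^'d" and l :: "'d \<Rightarrow> real"
    where u: "\<And>i. i \<in> S \<Longrightarrow> A *v u i = l i *\<^sub>R u i"
    "\<And>i j. i \<in> S \<Longrightarrow> j \<in> S \<Longrightarrow> (\<Sum>k\<in>UNIV. cnj (u i $ k) * u j $ k) = (if i = j then 1 else 0)"
    by auto
  \<comment> \<open>Real orthogonality to \<open>u i\<close> and to \<open>\<i> *s u i\<close> gives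
    the real and the imaginary part of Hermitian orthogonality to \<open>u i\<close>.\<close>
  define B where "B = u ` S \<union> (\<lambda>i. \<i> *s u i) ` S"
  define W where "W = {x. \<forall>b\<in>B. b \<bullet> x = 0}"
  have fB: "finite B"
    using insert.hyps by (simp add: B_def)
  have "card B \<le> card S + card S"
    unfolding B_def by (intro order.trans[OF card_Un_le] add_mono card_image_le insert.hyps)
  also have "\<dots> < DIM(complex^'d)"
    using psubset_card_mono[of "UNIV::'d set" S] insert.hyps by force
  finally have "dim (span B) < DIM(complex^'d)"
    using dim_le_card[OF _ fB, of "span B"] by simp
  then obtain w where w: "w \<noteq> 0" "\<And>y. y \<in> span B \<Longrightarrow> orthogonal w y"
    using orthogonal_to_subspace_exists[of B] by (metis dim_span)
  have wW: "w \<in> W"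
    using w(2) by (auto simp: W_def orthogonal_def inner_commute span_base)
  have sub: "subspace W"
    by (auto simp: W_def subspace_def inner_add_right)
  have inv: "A *v x \<in> W" if "x \<in> W" for x
  proof -
    have "b \<bullet> (A *v x) = 0" if b: "b \<in> B" for b
    proof -
      obtain i where i: "i \<in> S" "b = u i \<or> b = \<i> *s u i"
        using b unfolding B_def by blast
      then have "A *v b = l i *\<^sub>R b"
        using u(1)[OF i(1)] by (metis (no_types) vector_scalar_commute vector_smult_scaleR)
      then show ?thesis
        using \<open>x \<in> W\<close> b by (simp add: inner_self_adjoint[OF A] W_def)
    qed
    then show ?thesis by (simp add: W_def)
  qed
  from ex_eigenvector_in_invariant_subspace[OF A sub inv wW w(1)]
  obtain x lx where x: "x \<in> W" "norm x = 1" "A *v x = lx *\<^sub>R x"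
    by auto
  have ort: "(\<Sum>k\<in>UNIV. cnj (u i $ k) * x $ k) = 0" if "i \<in> S" for i
  proof (rule complex_eqI)
    have "u i \<bullet> x = 0" "(\<i> *s u i) \<bullet> x = 0"
      using x(1) that by (auto simp: W_def B_def)
    then show "Re (\<Sum>k\<in>UNIV. cnj (u i $ k) * x $ k) = Re 0" "Im (\<Sum>k\<in>UNIV. cnj (u i $ k) * x $ k) = Im 0"
      by (simp_all add: inner_complex_vec algebra_simps)
  qed
  have ort': "(\<Sum>k\<in>UNIV. cnj (x $ k) * u i $ k) = 0" if "i \<in> S" for i
    using arg_cong[OF ort[OF that], of cnj] by (simp add: mult.commute)
  have nrm: "(\<Sum>k\<in>UNIV. cnj (x $ k) * x $ k) = 1"
  proof (rule complex_eqI)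
    show "Re (\<Sum>k\<in>UNIV. cnj (x $ k) * x $ k) = Re 1"
      using x(2) by (simp add: inner_complex_vec[symmetric] norm_eq_1 del: Re_sum)
  qed (simp add: mult.commute)
  show ?case
    by (rule exI[of _ "u(a := x)"], rule exI[of _ "l(a := lx)"])
       (use insert.hyps u x ort ort' nrm in auto)
qed auto

theorem spectral_theorem:
  fixes A :: "complex^'d^'d"
  assumes A: "self_adjoint A"
  obtains U l where "unitary_mat U" "A = U ** diag_mat l ** adjoint_mat U"
proof -
  obtain u :: "'d \<Rightarrow> complex^'d" and l :: "'d \<Rightarrow> real"
    where u: "\<And>i. A *v u i = l i *\<^sub>R u i"
    "\<And>i j. (\<Sum>k\<in>UNIV. cnj (u i $ k) * u j $ k) = (if i = j then 1 else 0)"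
    using orthonormal_eigenvectors[OF A, of UNIV] by auto
  define U :: "complex^'d^'d" where "U = (\<chi> i j. u j $ i)"
  have 1: "adjoint_mat U ** U = mat 1"
    by (simp add: vec_eq_iff U_def matrix_matrix_mult_def u(2) mat_def)
  then have U: "unitary_mat U"
    using matrix_left_right_inverse by (auto simp: unitary_mat_def)
  have "A ** U = U ** diag_mat l"
  proof -
    have "(A ** U) $ i $ j = (U ** diag_mat l) $ i $ j" for i j
    proof -
      have "(A ** U) $ i $ j = (A *v u j) $ i"
        by (simp add: U_def matrix_matrix_mult_def matrix_vector_mult_def)
      also have "\<dots> = (U ** diag_mat l) $ i $ j"
        by (simp add: U_def u(1) matrix_matrix_mult_def diag_mat_def if_distrib scaleR_conv_of_real[where 'a=complex] mult.commute vector_scaleR_component del: of_real_mult cong: if_cong)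
      finally show ?thesis .
    qed
    then show ?thesis by (simp add: vec_eq_iff)
  qed
  then have "A = U ** diag_mat l ** adjoint_mat U"
    using U by (metis matrix_mul_assoc matrix_mul_rid unitary_mat_def)
  with U show ?thesis by (rule that)
qed

subsection \<open>Functional calculus\<close>

abbreviation conj_diag :: "complex^'d^'d \<Rightarrow> ('d \<Rightarrow> real) \<Rightarrow> complex^'d^'d" where
  "conj_diag U l \<equiv> U ** diag_mat l ** adjoint_mat U"

lemma unitary_mat_mult [simp]:
  assumes "unitary_mat U"
  shows "U ** adjoint_mat U = mat 1" "adjoint_mat U ** U = mat 1"
    "A ** U ** adjoint_mat U = A" "A ** adjoint_mat U ** U = A"
  using assms by (simp_all add: unitary_mat_def flip: matrix_mul_assoc)

lemma conj_diag_nth: "conj_diag U l $ i $ j = (\<Sum>k\<in>UNIV. U $ i $ k * complex_of_real (l k) * cnj (U $ j $ k))"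
  by (simp add: matrix_matrix_mult_def diag_mat_def if_distrib cong: if_cong)

lemma self_adjoint_conj_diag: "self_adjoint (conj_diag U l)"
  by (simp add: self_adjoint_def adjoint_mat_mult matrix_mul_assoc)

lemma diag_mat_mult_nth: "(A ** diag_mat l) $ i $ j = A $ i $ j * complex_of_real (l j)"
  "(diag_mat l ** A) $ i $ j = complex_of_real (l i) * A $ i $ j"
  by (simp_all add: matrix_matrix_mult_def diag_mat_def if_distrib if_distribR cong: if_cong)

text \<open>The choice in \<open>mat_fun\<close> may pick another decomposition, with
  \<open>V\<close> and \<open>e\<close>. The matrix \<open>W = adjoint_mat V ** U\<close>
  intertwines the two diagonals, so \<open>W $ i $ j\<close> vanishes unless
  \<open>l j = e i\<close>. Hence it also intertwines their images under \<open>f\<close>, and both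
  decompositions yield the same matrix.\<close>

lemma mat_fun_conj_diag:
  assumes U: "unitary_mat U"
  shows "mat_fun f (conj_diag U l) = conj_diag U (f \<circ> l)"
  unfolding mat_fun_def
proof (rule some_equality)
  fix B
  assume "\<exists>V e. unitary_mat V \<and> conj_diag U l = conj_diag V e \<and> B = conj_diag V (f \<circ> e)"
  then obtain V e where V: "unitary_mat V" and eq: "conj_diag U l = conj_diag V e"
    and B: "B = conj_diag V (f \<circ> e)" by blast
  define W where "W = adjoint_mat V ** U"
  have "W ** diag_mat l = diag_mat e ** W"
  proof -
    have "adjoint_mat V ** conj_diag U l ** U = adjoint_mat V ** conj_diag V e ** U"
      by (simp add: eq)
    then show ?thesis
      using U V by (simp add: W_def matrix_mul_assoc)
  qed
  then have "W $ i $ j * complex_of_real (l j) = complex_of_real (e i) * W $ i $ j" for i j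
    by (metis diag_mat_mult_nth)
  then have "W $ i $ j * complex_of_real (f (l j)) = complex_of_real (f (e i)) * W $ i $ j" for i j
    by (metis mult.commute mult_cancel_right of_real_eq_iff)
  then have "W ** diag_mat (f \<circ> l) = diag_mat (f \<circ> e) ** W"
    by (simp add: vec_eq_iff diag_mat_mult_nth)
  then have "V ** (W ** diag_mat (f \<circ> l)) ** adjoint_mat U = V ** (diag_mat (f \<circ> e) ** W) ** adjoint_mat U"
    by simp
  then show "B = conj_diag U (f \<circ> l)"
    using U V by (simp add: W_def B matrix_mul_assoc)
qed (use U in blast)

lemma self_adjoint_mat_fun: "self_adjoint A \<Longrightarrow> self_adjoint (mat_fun f A)"
  by (metis spectral_theorem mat_fun_conj_diag self_adjoint_conj_diag)

lemma conj_diag_scaleR: "c *\<^sub>R conj_diag U l = conj_diag U (\<lambda>i. c * l i)"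
  by (simp add: vec_eq_iff conj_diag_nth scaleR_conv_of_real[where 'a=complex] sum_distrib_left mult_ac)

lemma conj_diag_add: "conj_diag U l + conj_diag U m = conj_diag U (\<lambda>i. l i + m i)"
  by (simp add: vec_eq_iff conj_diag_nth algebra_simps sum.distrib)

lemma conj_diag_diff: "conj_diag U l - conj_diag U m = conj_diag U (\<lambda>i. l i - m i)"
  by (simp add: vec_eq_iff conj_diag_nth algebra_simps sum_subtractf)

lemma conj_diag_one: "unitary_mat U \<Longrightarrow> conj_diag U (\<lambda>_. 1) = mat 1"
proof -
  have "diag_mat (\<lambda>_::'a. 1) = (mat 1 :: complex^'a^'a)"
    by (simp add: vec_eq_iff diag_mat_def mat_def)
  then show "unitary_mat U \<Longrightarrow> ?thesis" by simp
qed

lemma conj_diag_mult: "unitary_mat U \<Longrightarrow> conj_diag U l ** conj_diag U m = conj_diag U (\<lambda>i. l i * m i)"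
proof -
  assume U: "unitary_mat U"
  have "diag_mat l ** diag_mat m = (diag_mat (\<lambda>i. l i * m i) :: complex^'a^'a)"
    by (simp add: vec_eq_iff diag_mat_mult_nth) (simp add: diag_mat_def)
  then have "U ** (diag_mat l ** diag_mat m) ** adjoint_mat U = conj_diag U (\<lambda>i. l i * m i)"
    by simp
  then show ?thesis using U by (simp add: matrix_mul_assoc)
qed

lemma trace_conj_diag: "unitary_mat U \<Longrightarrow> trace (conj_diag U l) = (\<Sum>i\<in>UNIV. complex_of_real (l i))"
  by (subst trace_mul_sym) (simp add: matrix_mul_assoc, simp add: trace_def diag_mat_def)

lemma inner_conj_diag:
  "x \<bullet> (conj_diag U l *v x) = (\<Sum>i\<in>UNIV. l i * (cmod ((adjoint_mat U *v x) $ i))\<^sup>2)"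
proof -
  define y where "y = adjoint_mat U *v x"
  have "x \<bullet> (conj_diag U l *v x) = y \<bullet> (diag_mat l *v y)"
    unfolding y_def using inner_matrix_vector[of x U "diag_mat l *v (adjoint_mat U *v x)"]
    by (simp only: matrix_vector_mul_assoc matrix_mul_assoc)
  also have "\<dots> = (\<Sum>i\<in>UNIV. l i * (cmod (y $ i))\<^sup>2)"
    unfolding inner_complex_vec
    by (simp add: matrix_vector_mult_def diag_mat_def if_distrib if_distribR cmod_power2 cong: if_cong)
       (simp add: power2_eq_square algebra_simps)
  finally show ?thesis by (simp add: y_def)
qed

lemma sum_cmod_unitary:
  "unitary_mat U \<Longrightarrow> (\<Sum>i\<in>UNIV. (cmod ((adjoint_mat U *v x) $ i))\<^sup>2) = (norm x)\<^sup>2"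
  using inner_conj_diag[of x U "\<lambda>_. 1"] by (simp only: conj_diag_one) (simp add: dot_square_norm)

lemma norm_column_unitary:
  assumes "unitary_mat U" shows "norm (column i U) = 1"
proof -
  have "(adjoint_mat U ** U) $ i $ i = 1"
    using assms by (simp add: mat_def)
  then have "column i U \<bullet> column i U = 1"
    by (simp add: inner_complex_vec column_def matrix_matrix_mult_def del: Re_sum)
  then show ?thesis by (simp add: norm_eq_1)
qed

lemma conj_diag_column:
  assumes "unitary_mat U" shows "conj_diag U l *v column i U = l i *\<^sub>R column i U"
proof -
  have "conj_diag U l ** U = U ** diag_mat l"
    using assms by simp
  then have "(conj_diag U l ** U) $ j $ i = (U ** diag_mat l) $ j $ i" for j
    by simp
  then show ?thesis
    unfolding diag_mat_mult_nth
    by (simp add: vec_eq_iff column_def matrix_vector_mult_def matrix_matrix_mult_def scaleR_conv_of_real[where 'a=complex] mult.commute)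
qed

lemma trace_unitary_columns:
  assumes "unitary_mat U"
  shows "Re (trace A) = (\<Sum>i\<in>UNIV. column i U \<bullet> (A *v column i U))"
proof -
  have "trace A = trace (adjoint_mat U ** (A ** U))"
    using assms by (subst trace_mul_sym) simp
  also have "Re \<dots> = (\<Sum>i\<in>UNIV. column i U \<bullet> (A *v column i U))"
    by (simp add: trace_def inner_complex_vec column_def matrix_vector_mult_def matrix_matrix_mult_def)
  finally show ?thesis .
qed

section \<open>Quadratic forms and traces of matrix functions\<close>

lemma inner_mat_fun_mono:
  assumes "self_adjoint A" and "\<And>x. f x \<le> g x"
  shows "x \<bullet> (mat_fun f A *v x) \<le> x \<bullet> (mat_fun g A *v x)"
proof -
  obtain U l where U: "unitary_mat U" "A = conj_diag U l"
    using spectral_theorem assms(1) by blast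
  show ?thesis
    unfolding U(2) mat_fun_conj_diag[OF U(1)] inner_conj_diag
    by (intro sum_mono mult_right_mono) (auto simp: assms(2))
qed

text \<open>Jensen's inequality: the squared moduli of the coordinates of the unit vector
  \<open>x\<close> in an eigenbasis are weights with sum one.\<close>

lemma convex_inner_mat_fun:
  assumes f: "convex_on UNIV f" and A: "self_adjoint A" and x: "norm x = 1"
  shows "f (x \<bullet> (A *v x)) \<le> x \<bullet> (mat_fun f A *v x)"
proof -
  obtain U l where U: "unitary_mat U" "A = conj_diag U l"
    using spectral_theorem A by blast
  show ?thesis
    unfolding U(2) mat_fun_conj_diag[OF U(1)] inner_conj_diag
    using convex_on_sum[OF _ _ f, of UNIV "\<lambda>i. (cmod ((adjoint_mat U *v x) $ i))\<^sup>2" l] sum_cmod_unitary[OF U(1), of x] x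
    by (simp add: mult.commute)
qed

text \<open>Peierls' inequality, applied to the eigenbasis of the smaller matrix.\<close>

lemma trace_exp_mono:
  assumes A: "self_adjoint A" and B: "self_adjoint B"
    and le: "\<And>x. x \<bullet> (A *v x) \<le> x \<bullet> (B *v x)"
  shows "Re (trace (mat_fun exp A)) \<le> Re (trace (mat_fun exp B))"
proof -
  obtain U l where U: "unitary_mat U" "A = conj_diag U l"
    using spectral_theorem A by blast
  have "Re (trace (mat_fun exp A)) = (\<Sum>i\<in>UNIV. exp (l i))"
    by (simp add: U mat_fun_conj_diag trace_conj_diag)
  also have "\<dots> \<le> (\<Sum>i\<in>UNIV. column i U \<bullet> (mat_fun exp B *v column i U))"
  proof (rule sum_mono)
    fix i
    have "l i = column i U \<bullet> (A *v column i U)"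
      using norm_column_unitary[OF U(1), of i] by (simp add: U conj_diag_column norm_eq_1)
    also have "\<dots> \<le> column i U \<bullet> (B *v column i U)"
      by (rule le)
    finally have "exp (l i) \<le> exp (column i U \<bullet> (B *v column i U))"
      by simp
    also have "\<dots> \<le> column i U \<bullet> (mat_fun exp B *v column i U)"
      by (rule convex_inner_mat_fun[OF exp_convex B norm_column_unitary[OF U(1)]])
    finally show "exp (l i) \<le> \<dots>" .
  qed
  also have "\<dots> = Re (trace (mat_fun exp B))"
    by (rule trace_unitary_columns[OF U(1), symmetric])
  finally show ?thesis .
qed

lemma trace_exp_nonneg: "self_adjoint A \<Longrightarrow> 0 \<le> Re (trace (mat_fun exp A))"
  by (metis (no_types, lifting) spectral_theorem mat_fun_conj_diag trace_conj_diag Re_sum Re_complex_of_real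
      comp_apply exp_ge_zero sum_nonneg)

section \<open>Operator norm and eigenvalues\<close>

lemma op_norm_conj_diag_le:
  assumes U: "unitary_mat U" and l: "\<And>i. \<bar>l i\<bar> \<le> b"
  shows "op_norm (conj_diag U l) \<le> b"
  unfolding op_norm_def
proof (rule onorm_bound)
  show b0: "0 \<le> b" using l[of undefined] by linarith
  fix x :: "complex^'a"
  have "(norm (conj_diag U l *v x))\<^sup>2 = x \<bullet> (conj_diag U (\<lambda>i. l i * l i) *v x)"
    by (simp add: inner_self_adjoint[OF self_adjoint_conj_diag] matrix_vector_mul_assoc conj_diag_mult[OF U, symmetric]
        flip: dot_square_norm) 
       (metis inner_self_adjoint matrix_vector_mul_assoc self_adjoint_conj_diag)
  also have "\<dots> \<le> (\<Sum>i\<in>UNIV. b\<^sup>2 * (cmod ((adjoint_mat U *v x) $ i))\<^sup>2)"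
    unfolding inner_conj_diag
    using abs_le_square_iff[THEN iffD1] l b0
    by (intro sum_mono mult_right_mono) (auto simp flip: power2_eq_square intro: abs_le_square_iff[THEN iffD1])
  also have "\<dots> = (b * norm x)\<^sup>2"
    by (simp add: sum_distrib_left[symmetric] sum_cmod_unitary[OF U] power_mult_distrib)
  finally show "norm (conj_diag U l *v x) \<le> b * norm x"
    using b0 by (simp add: power2_le_iff_abs_le)
qed

lemma le_op_norm_conj_diag:
  assumes "unitary_mat U" shows "\<bar>l i\<bar> \<le> op_norm (conj_diag U l)"
  using onorm[OF matrix_vector_mul_bounded_linear, of "conj_diag U l" "column i U"] assms
  by (simp add: op_norm_def conj_diag_column norm_column_unitary)

text \<open>The norm is at most the largest modulus of an eigenvalue, a maximum over a finite set
  that is attained. In the tail bound this turns a large norm into a single large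
  eigenvalue.\<close>

lemma ex_eigenvalue_ge_op_norm:
  assumes "unitary_mat U" "s \<le> op_norm (conj_diag U l)"
  shows "\<exists>i. s \<le> \<bar>l i\<bar>"
proof -
  have "op_norm (conj_diag U l) \<le> Max (range (\<lambda>i. \<bar>l i\<bar>))"
    by (rule op_norm_conj_diag_le[OF assms(1)]) simp
  moreover have "Max (range (\<lambda>i. \<bar>l i\<bar>)) \<in> range (\<lambda>i. \<bar>l i\<bar>)"
    by (rule Max_in) auto
  ultimately show ?thesis using assms(2) by (metis (no_types, lifting) imageE order_trans)
qed

subsection \<open>Measurability of the functional calculus\<close>

text \<open>The overloaded power on this type acts entrywise, so powers with respect to
  \<open>**\<close> have their own recursion.\<close>

primrec mat_power :: "complex^'d^'d \<Rightarrow> nat \<Rightarrow> complex^'d^'d" where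
  "mat_power A 0 = mat 1"
| "mat_power A (Suc k) = A ** mat_power A k"

lemma mat_power_conj_diag: "unitary_mat U \<Longrightarrow> mat_power (conj_diag U l) k = conj_diag U (\<lambda>i. l i ^ k)"
  by (induction k) (simp_all only: mat_power.simps power.simps conj_diag_one conj_diag_mult)

lemma continuous_on_matrix_mult:
  fixes f g :: "'a::topological_space \<Rightarrow> complex^'d^'d"
  assumes "continuous_on S f" "continuous_on S g"
  shows "continuous_on S (\<lambda>x. f x ** g x)"
  unfolding matrix_matrix_mult_def
  by (intro continuous_on_vec_lambda continuous_intros continuous_on_component assms)

lemma continuous_on_mat_power: "continuous_on S f \<Longrightarrow> continuous_on S (\<lambda>x. mat_power (f x) k)"
  by (induction k) (auto intro: continuous_on_matrix_mult continuous_intros)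

lemma conj_diag_poly:
  assumes "unitary_mat U"
  shows "(\<Sum>i\<le>m. a i *\<^sub>R mat_power (conj_diag U l) i) = conj_diag U (\<lambda>j. \<Sum>i\<le>m. a i * l j ^ i)"
  by (induction m) (simp_all add: mat_power_conj_diag[OF assms] conj_diag_scaleR conj_diag_add del: mat_power.simps)

lemma tendsto_conj_diag:
  assumes "\<And>i. ((\<lambda>n. l n i) \<longlongrightarrow> m i) F"
  shows "((\<lambda>n. conj_diag U (l n)) \<longlongrightarrow> conj_diag U m) F"
  by (intro vec_tendstoI, simp only: conj_diag_nth) (intro tendsto_intros assms)

definition herm_part :: "complex^'d^'d \<Rightarrow> complex^'d^'d" where
  "herm_part A = (1/2) *\<^sub>R (A + adjoint_mat A)"

lemma self_adjoint_herm_part: "self_adjoint (herm_part A)"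
  by (simp add: self_adjoint_def herm_part_def adjoint_mat_scaleR adjoint_mat_add add.commute)

lemma herm_part_self_adjoint: "self_adjoint A \<Longrightarrow> herm_part A = A"
  by (simp add: self_adjoint_def herm_part_def scaleR_2[symmetric])

lemma continuous_on_herm_part: "continuous_on S herm_part"
  unfolding herm_part_def adjoint_mat_def
  by (intro continuous_intros continuous_on_vec_lambda continuous_on_component)

text \<open>On matrices that are not self-adjoint \<^const>\<open>mat_fun\<close> is arbitrary, hence the projection
  to the Hermitian part.\<close>

lemma borel_measurable_mat_fun:
  fixes f :: "real \<Rightarrow> real"
  assumes f: "continuous_on UNIV f"
  shows "(\<lambda>A::complex^'d^'d. mat_fun f (herm_part A)) \<in> borel_measurable borel"
proof -
  \<comment> \<open>Polynomials in a matrix are continuous in its entries, so \<open>f\<close> is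
    approximated by polynomials to within \<open>1 / (n + 1)\<close> on \<open>[-n, n]\<close>.
    These intervals eventually contain any given spectrum, and a pointwise limit of measurable maps
    is measurable, without a measurable choice of eigenvectors.\<close>
  have "\<exists>m a. \<forall>x\<in>{-real n..real n}. \<bar>f x - (\<Sum>i\<le>m. a i * x ^ i)\<bar> < inverse (real (Suc n))" for n
  proof -
    obtain p where p: "polynomial_function p" "\<forall>x\<in>{-real n..real n}. norm (f x - p x) < inverse (real (Suc n))"
      using Stone_Weierstrass_polynomial_function[of "{-real n..real n}" f "inverse (real (Suc n))"]
        continuous_on_subset[OF f] by auto
    then show ?thesis
      using real_polynomial_function_iff_sum[of p] by (auto simp: real_polynomial_function_eq)
  qed
  then obtain m a where "\<forall>n. \<forall>x\<in>{-real n..real n}. \<bar>f x - (\<Sum>i\<le>m n. a n i * x ^ i)\<bar> < inverse (real (Suc n))"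
    by metis
  then have ma: "\<bar>f x - (\<Sum>i\<le>m n. a n i * x ^ i)\<bar> < inverse (real (Suc n))" if "\<bar>x\<bar> \<le> real n" for n x
    using that by (auto simp: abs_le_iff)
  show ?thesis
  proof (rule borel_measurable_LIMSEQ_metric)
    show "(\<lambda>A::complex^'d^'d. \<Sum>i\<le>m n. a n i *\<^sub>R mat_power (herm_part A) i) \<in> borel_measurable borel" for n
      by (intro borel_measurable_continuous_onI continuous_intros continuous_on_mat_power continuous_on_herm_part)
    fix A :: "complex^'d^'d"
    obtain U l where U: "unitary_mat U" "herm_part A = conj_diag U l"
      using spectral_theorem self_adjoint_herm_part by blast
    have lim: "(\<lambda>n. \<Sum>i\<le>m n. a n i * x ^ i) \<longlonglongrightarrow> f x" for x
    proof (rule LIM_zero_cancel, rule Lim_null_comparison)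
      obtain N where "\<bar>x\<bar> \<le> real N"
        using real_arch_simple by blast
      then have "\<bar>x\<bar> \<le> real n" if "n \<ge> N" for n
        using that by (meson of_nat_mono order_trans)
      then show "\<forall>\<^sub>F n in sequentially. norm ((\<Sum>i\<le>m n. a n i * x ^ i) - f x) \<le> inverse (real (Suc n))"
        using ma by (intro eventually_sequentiallyI[of N]) (fastforce simp: abs_minus_commute intro: less_imp_le)
      show "(\<lambda>n. inverse (real (Suc n))) \<longlonglongrightarrow> 0"
        by (rule LIMSEQ_inverse_real_of_nat)
    qed
    show "(\<lambda>n. \<Sum>i\<le>m n. a n i *\<^sub>R mat_power (herm_part A) i) \<longlonglongrightarrow> mat_fun f (herm_part A)"
      unfolding U mat_fun_conj_diag[OF U(1)] conj_diag_poly[OF U(1)] comp_def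
      by (intro tendsto_conj_diag lim)
  qed
qed

subsection \<open>A tangent functional for Lieb's concave trace function\<close>

lemma convex_combination_pos:
  fixes a t :: real
  assumes "a > 0" "t > 0" "s \<in> {0..1}"
  shows "a + s * (t - a) > 0"
proof -
  have "a + s * (t - a) = (1 - s) * a + s * t" by (simp add: algebra_simps)
  then show ?thesis using assms by (cases "s = 0") (auto intro: add_nonneg_pos)
qed

text \<open>Taylor's formula with integral remainder for \<open>x * ln x\<close> around
  \<open>a\<close>, whose second derivative is \<open>1 / x\<close>; the value is the first-order
  remainder at \<open>t\<close>.\<close>

lemma has_integral_relative_entropy:
  fixes t a :: real
  assumes "t > 0" "a > 0"
  shows "((\<lambda>s. (1 - s) * ((t - a)\<^sup>2 / (a + s * (t - a)))) has_integral (t * ln t - t * ln a - t + a)) {0..1}"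
proof -
  note pos = convex_combination_pos[OF assms(2,1)]
  let ?F = "\<lambda>s. t * ln (a + s * (t - a)) - s * (t - a)"
  have "((\<lambda>s. (1 - s) * ((t - a)\<^sup>2 / (a + s * (t - a)))) has_integral ?F 1 - ?F 0) {0..1}"
  proof (rule fundamental_theorem_of_calculus)
    fix s :: real assume s: "s \<in> {0..1}"
    have "(?F has_real_derivative (1 - s) * ((t - a)\<^sup>2 / (a + s * (t - a)))) (at s within {0..1})"
      using pos[OF s] by (auto intro!: derivative_eq_intros simp: field_simps power2_eq_square)
    then show "(?F has_vector_derivative (1 - s) * ((t - a)\<^sup>2 / (a + s * (t - a)))) (at s within {0..1})"
      by (simp add: has_real_derivative_iff_has_vector_derivative)
  qed simp
  then show ?thesis by (simp add: algebra_simps)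
qed

text \<open>The divided difference of \<open>x ln x - x\<close>.\<close>

definition log_kernel :: "real \<Rightarrow> real \<Rightarrow> real" where
  "log_kernel t t' = (if t = t' then ln t else t * (ln t - ln t') / (t - t') + ln t' - 1)"

text \<open>\<open>r s\<close> and \<open>r' s\<close> are the factors by which the optimal matrix
  below scales two entries of one column. The dependence on \<open>a\<close> splits off as
  \<open>- ln a\<close>, which lets the matrix version collapse to a difference of
  logarithms.\<close>

lemma has_integral_log_kernel:
  fixes t t' a :: real
  assumes "t > 0" "t' > 0" "a > 0"
  defines "r \<equiv> \<lambda>s. (t - a) / (a + s * (t - a))" and "r' \<equiv> \<lambda>s. (t' - a) / (a + s * (t' - a))"
  shows "((\<lambda>s. (1 - s) * (r s + r' s - s * (r s * r' s))) has_integral (log_kernel t t' - ln a)) {0..1}"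
proof -
  note pos = convex_combination_pos[OF \<open>a > 0\<close>]
  \<comment> \<open>By partial fractions \<open>t * a / (m * m')\<close>, with \<open>m\<close> and
    \<open>m'\<close> the two denominators, integrates to a difference of logarithms; for
    \<open>t = t'\<close> this degenerates to a rational function.\<close>
  define F where "F = (\<lambda>s. (if t = t' then t * s / (a + s * (t - a))
      else t * (ln (a + s * (t - a)) - ln (a + s * (t' - a))) / (t - t')) + ln (a + s * (t' - a)) - s)"
  have "((\<lambda>s. (1 - s) * (r s + r' s - s * (r s * r' s))) has_integral F 1 - F 0) {0..1}"
  proof (rule fundamental_theorem_of_calculus)
    fix s :: real assume s: "s \<in> {0..1}"
    define m m' where "m = a + s * (t - a)" and "m' = a + s * (t' - a)"
    have m: "m > 0" "m' > 0"
      unfolding m_def m'_def using pos s assms by auto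
    have eq: "(1 - s) * (r s + r' s - s * (r s * r' s)) = t * (a / (m * m')) + (t' - a) / m' - 1"
    proof -
      have "r s = (t - a) / m" "r' s = (t' - a) / m'"
        by (simp_all add: r_def r'_def m_def m'_def)
      moreover have num: "(1 - s) * ((t - a) * m' + (t' - a) * m - s * ((t - a) * (t' - a))) = t * a + (t' - a) * m - m * m'"
        unfolding m_def m'_def by algebra
      have comb: "(1 - s) * (u / m + v / m' - s * (u / m * (v / m'))) = (1 - s) * (u * m' + v * m - s * (u * v)) / (m * m')" for u v
        using m by (simp add: field_simps)
      ultimately have "(1 - s) * (r s + r' s - s * (r s * r' s)) = (t * a + (t' - a) * m - m * m') / (m * m')"
        by (simp only: comb num)
      also have "\<dots> = t * (a / (m * m')) + (t' - a) / m' - 1"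
        using m by (simp add: field_simps)
      finally show ?thesis .
    qed
    have "(F has_real_derivative t * (a / (m * m')) + (t' - a) / m' - 1) (at s within {0..1})"
    proof (cases "t = t'")
      case True
      then have F: "F = (\<lambda>s. t * s / (a + s * (t - a)) + ln (a + s * (t - a)) - s)" and [simp]: "m' = m"
        by (simp_all add: F_def m_def m'_def)
      have "(F has_real_derivative (t * m - t * s * (t - a)) / (m * m) + (t - a) / m - 1) (at s within {0..1})"
        unfolding F using m by (auto intro!: derivative_eq_intros simp: m_def)
      moreover have "t * m - t * s * (t - a) = t * a"
        by (simp add: m_def algebra_simps)
      ultimately show ?thesis by (simp add: True)
    next
      case False
      have "(F has_real_derivative t * ((t - a) / m - (t' - a) / m') / (t - t') + (t' - a) / m' - 1) (at s within {0..1})"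
        unfolding F_def using m False
        by (auto intro!: derivative_eq_intros simp: m_def m'_def)
      moreover have "((t - a) / m - (t' - a) / m') / (t - t') = a / (m * m')"
      proof -
        have "(t - a) * m' - (t' - a) * m = a * (t - t')"
          unfolding m_def m'_def by algebra
        then show ?thesis using m False by (simp add: divide_simps)
      qed
      ultimately show ?thesis
        by (metis times_divide_eq_right)
    qed
    then show "(F has_vector_derivative (1 - s) * (r s + r' s - s * (r s * r' s))) (at s within {0..1})"
      by (simp add: has_real_derivative_iff_has_vector_derivative eq)
  qed simp
  moreover have "F 1 - F 0 = log_kernel t t' - ln a"
    using assms by (auto simp: F_def log_kernel_def)
  ultimately show ?thesis by simp
qed

section \<open>Variational form of the relative entropy\<close>

lemma trace_adjoint_mult: "trace (adjoint_mat X ** Y) = (\<Sum>i\<in>UNIV. \<Sum>j\<in>UNIV. cnj (X $ i $ j) * Y $ i $ j)"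
  unfolding trace_def matrix_matrix_mult_def by (subst sum.swap) simp

text \<open>The squared overlaps of the two eigenbases act as weights, which reduces trace
  identities for two non-commuting matrices to scalar identities for pairs of eigenvalues.\<close>

lemma trace_conj_diag_mult:
  "Re (trace (conj_diag U l ** conj_diag V m))
    = (\<Sum>i\<in>UNIV. \<Sum>j\<in>UNIV. l i * m j * (cmod ((adjoint_mat U ** V) $ i $ j))\<^sup>2)"
proof -
  define C where "C = adjoint_mat U ** V"
  have "trace (conj_diag U l ** conj_diag V m) = trace (U ** (diag_mat l ** C ** diag_mat m ** adjoint_mat V))"
    by (simp add: C_def matrix_mul_assoc)
  also have "\<dots> = trace ((diag_mat l ** C ** diag_mat m) ** adjoint_mat C)"
    by (subst trace_mul_sym) (simp add: C_def matrix_mul_assoc adjoint_mat_mult)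
  also have "\<dots> = trace (adjoint_mat C ** (diag_mat l ** C ** diag_mat m))"
    by (rule trace_mul_sym)
  also have "Re \<dots> = (\<Sum>i\<in>UNIV. \<Sum>j\<in>UNIV. l i * m j * (cmod (C $ i $ j))\<^sup>2)"
    unfolding trace_adjoint_mult diag_mat_mult_nth
    by (simp add: cmod_power2) (simp add: power2_eq_square algebra_simps)
  finally show ?thesis by (simp add: C_def)
qed

text \<open>For fixed \<open>X\<close> this is linear in \<open>(T, A)\<close>, and its supremum over \<open>X\<close> is the
  quadratic form of the resolvent of \<open>s L\<^sub>T + (1 - s) R\<^sub>A\<close> at \<open>T - A\<close>.\<close>

definition resolvent_form :: "real \<Rightarrow> complex^'d^'d \<Rightarrow> complex^'d^'d \<Rightarrow> complex^'d^'d \<Rightarrow> real" where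
  "resolvent_form s X T A = 2 * Re (trace (adjoint_mat X ** (T - A)))
     - s * Re (trace (adjoint_mat X ** (T ** X))) - (1 - s) * Re (trace (adjoint_mat X ** (X ** A)))"

text \<open>The two eigenbases diagonalize left multiplication by \<open>T\<close> and right
  multiplication by \<open>A\<close> simultaneously, so the form decouples over the entries of
  \<open>R\<close>.\<close>

lemma resolvent_form_eq:
  assumes U: "unitary_mat U" and V: "unitary_mat V"
  defines "C \<equiv> adjoint_mat U ** V"
  shows "resolvent_form s (U ** R ** adjoint_mat V) (conj_diag U t) (conj_diag V a)
    = (\<Sum>i\<in>UNIV. \<Sum>j\<in>UNIV. 2 * (t i - a j) * (R $ i $ j \<bullet> C $ i $ j) - (a j + s * (t i - a j)) * (cmod (R $ i $ j))\<^sup>2)"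
proof -
  define X where "X = U ** R ** adjoint_mat V"
  have adj: "adjoint_mat X = V ** adjoint_mat R ** adjoint_mat U"
    by (simp add: X_def adjoint_mat_mult matrix_mul_assoc)
  have conj: "trace (V ** B ** adjoint_mat V) = trace B" for B
    using V by (subst trace_mul_sym) (simp add: matrix_mul_assoc)
  have 1: "trace (adjoint_mat X ** conj_diag U t) = trace (adjoint_mat R ** (diag_mat t ** C))"
  proof -
    have "adjoint_mat X ** conj_diag U t = V ** (adjoint_mat R ** (diag_mat t ** C)) ** adjoint_mat V"
      using U V by (simp add: adj C_def matrix_mul_assoc)
    then show ?thesis by (simp add: conj)
  qed
  have 2: "trace (adjoint_mat X ** conj_diag V a) = trace (adjoint_mat R ** (C ** diag_mat a))"
  proof -
    have "adjoint_mat X ** conj_diag V a = V ** (adjoint_mat R ** (C ** diag_mat a)) ** adjoint_mat V"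
      using U V by (simp add: adj C_def matrix_mul_assoc)
    then show ?thesis by (simp add: conj)
  qed
  have 3: "trace (adjoint_mat X ** (conj_diag U t ** X)) = trace (adjoint_mat R ** (diag_mat t ** R))"
  proof -
    have "adjoint_mat X ** (conj_diag U t ** X) = V ** (adjoint_mat R ** (diag_mat t ** R)) ** adjoint_mat V"
      using U V by (simp add: adj matrix_mul_assoc) (simp add: X_def matrix_mul_assoc U)
    then show ?thesis by (simp add: conj)
  qed
  have 4: "trace (adjoint_mat X ** (X ** conj_diag V a)) = trace (adjoint_mat R ** (R ** diag_mat a))"
  proof -
    have "adjoint_mat X ** (X ** conj_diag V a) = V ** (adjoint_mat R ** (R ** diag_mat a)) ** adjoint_mat V"
      using U V by (simp add: adj matrix_mul_assoc) (simp add: X_def matrix_mul_assoc U V)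
    then show ?thesis by (simp add: conj)
  qed
  show ?thesis
    unfolding resolvent_form_def X_def[symmetric] matrix_mult_diff_right trace_sub 1 2 3 4
    unfolding trace_adjoint_mult diag_mat_mult_nth
    by (simp add: sum_distrib_left sum_subtractf[symmetric] cmod_power2 inner_complex_def)
       (simp add: power2_eq_square algebra_simps)
qed

text \<open>Each entry of the rotated \<open>X\<close> contributes a concave quadratic, since
  \<open>a j + s * (t i - a j)\<close> is positive; completing the square bounds it by its
  maximum.\<close>

lemma resolvent_form_le:
  assumes U: "unitary_mat U" and V: "unitary_mat V" and t: "\<And>i. t i > 0" and a: "\<And>j. a j > 0" and s: "s \<in> {0..1}"
  shows "resolvent_form s X (conj_diag U t) (conj_diag V a)
    \<le> (\<Sum>i\<in>UNIV. \<Sum>j\<in>UNIV. (cmod ((adjoint_mat U ** V) $ i $ j))\<^sup>2 * ((t i - a j)\<^sup>2 / (a j + s * (t i - a j))))"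
proof -
  define R where "R = adjoint_mat U ** X ** V"
  define C where "C = adjoint_mat U ** V"
  have X: "X = U ** R ** adjoint_mat V"
    using U V by (simp add: R_def matrix_mul_assoc)
  have "2 * d * (x \<bullet> c) - m * (cmod x)\<^sup>2 \<le> (cmod c)\<^sup>2 * (d\<^sup>2 / m)" if "m > 0" for d m :: real and x c :: complex
  proof -
    have "0 \<le> (m *\<^sub>R x - d *\<^sub>R c) \<bullet> (m *\<^sub>R x - d *\<^sub>R c)"
      by (rule inner_ge_zero)
    also have "\<dots> = m * (m * (cmod x)\<^sup>2) - m * (2 * d * (x \<bullet> c)) + d\<^sup>2 * (cmod c)\<^sup>2"
      unfolding power2_norm_eq_inner
      by (simp add: inner_diff_left inner_diff_right inner_commute power2_eq_square algebra_simps del: dot_square_norm)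
    finally show ?thesis using that by (simp add: field_simps)
  qed
  note * = this[OF convex_combination_pos[OF a t s]]
  show ?thesis
    unfolding X resolvent_form_eq[OF U V] by (intro sum_mono *)
qed

text \<open>The entrywise maximizer from the completed square, rotated back. It solves
  \<open>s T X + (1 - s) X A = T - A\<close> for \<open>T = conj_diag U t\<close> and
  \<open>A = conj_diag V a\<close>.\<close>

definition opt_matrix :: "complex^'d^'d \<Rightarrow> ('d \<Rightarrow> real) \<Rightarrow> complex^'d^'d \<Rightarrow> ('d \<Rightarrow> real) \<Rightarrow> real \<Rightarrow> complex^'d^'d" where
  "opt_matrix U t V a s =
     U ** (\<chi> i j. complex_of_real ((t i - a j) / (a j + s * (t i - a j))) * (adjoint_mat U ** V) $ i $ j) ** adjoint_mat V"

lemma resolvent_form_opt_matrix: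
  assumes U: "unitary_mat U" and V: "unitary_mat V" and t: "\<And>i. t i > 0" and a: "\<And>j. a j > 0" and s: "s \<in> {0..1}"
  shows "resolvent_form s (opt_matrix U t V a s) (conj_diag U t) (conj_diag V a)
    = (\<Sum>i\<in>UNIV. \<Sum>j\<in>UNIV. (cmod ((adjoint_mat U ** V) $ i $ j))\<^sup>2 * ((t i - a j)\<^sup>2 / (a j + s * (t i - a j))))"
proof -
  have "2 * d * ((complex_of_real (d / m) * c) \<bullet> c) - m * (cmod (complex_of_real (d / m) * c))\<^sup>2 = (cmod c)\<^sup>2 * (d\<^sup>2 / m)"
    if "m > 0" for d m :: real and c :: complex
  proof -
    have "(complex_of_real k * c) \<bullet> c = k * (cmod c)\<^sup>2" for k
      by (simp add: inner_complex_def cmod_power2) (simp add: power2_eq_square algebra_simps)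
    moreover have "(cmod (complex_of_real k * c))\<^sup>2 = k\<^sup>2 * (cmod c)\<^sup>2" for k
      by (simp add: norm_mult power_mult_distrib)
    ultimately show ?thesis
      using that by (simp add: power_divide del: of_real_divide) (simp add: power2_eq_square field_simps)
  qed
  note * = this[OF convex_combination_pos[OF a t s]]
  show ?thesis
    unfolding opt_matrix_def resolvent_form_eq[OF U V] vec_lambda_beta by (intro sum.cong refl *)
qed

lemma continuous_on_opt_matrix:
  assumes t: "\<And>i. t i > 0" and a: "\<And>j. a j > 0"
  shows "continuous_on {0..1} (opt_matrix U t V a)"
proof -
  have "a j + s * (t i - a j) \<noteq> 0" if "s \<in> {0..1}" for s i j
    using convex_combination_pos[OF a t that] by (metis less_irrefl)
  then show ?thesis
    unfolding opt_matrix_def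
    by (intro continuous_on_matrix_mult continuous_on_vec_lambda continuous_intros) auto
qed

lemma continuous_on_Re_trace:
  assumes "continuous_on S f"
  shows "continuous_on S (\<lambda>x. Re (trace (f x :: complex^'d^'d)))"
  unfolding trace_def by (intro continuous_intros continuous_on_component assms)

lemma continuous_on_adjoint_mat:
  assumes "continuous_on S f"
  shows "continuous_on S (\<lambda>x. adjoint_mat (f x))"
  unfolding adjoint_mat_def by (intro continuous_intros continuous_on_vec_lambda continuous_on_component assms)

lemmas continuous_on_trace_intros =
  continuous_on_Re_trace continuous_on_adjoint_mat continuous_on_matrix_mult

text \<open>The \<open>T\<close>-part of the tangent functional of the relative entropy at \<open>(conj_diag U t, conj_diag V a)\<close>.\<close>

lemma has_integral_opt_matrix:
  fixes U V T :: "complex^'d^'d"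
  assumes U: "unitary_mat U" and V: "unitary_mat V" and t: "\<And>i. t i > 0" and a: "\<And>j. a j > 0"
    and T: "self_adjoint T"
  defines "X \<equiv> opt_matrix U t V a"
  shows "((\<lambda>s. (1 - s) * (2 * Re (trace (adjoint_mat (X s) ** T)) - s * Re (trace (adjoint_mat (X s) ** (T ** X s)))))
    has_integral Re (trace (T ** (conj_diag U (ln \<circ> t) - conj_diag V (ln \<circ> a))))) {0..1}"
proof -
  define C where "C = adjoint_mat U ** V"
  define K where "K = adjoint_mat U ** T ** U"
  define r where "r = (\<lambda>s i j. (t i - a j) / (a j + s * (t i - a j)))"
  define R :: "real \<Rightarrow> complex^'d^'d" where "R = (\<lambda>s. \<chi> i j. complex_of_real (r s i j) * C $ i $ j)"
  define q where "q = (\<lambda>i j k. Re (cnj (C $ i $ j) * K $ i $ k * C $ k $ j))"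
  have K: "self_adjoint K"
    using T by (simp add: self_adjoint_def K_def adjoint_mat_mult matrix_mul_assoc)
  have TK: "T = U ** K ** adjoint_mat U"
    using U by (simp add: K_def matrix_mul_assoc)
  have X: "X s = U ** R s ** adjoint_mat V" for s
    by (simp add: X_def opt_matrix_def R_def r_def C_def)
  have adj: "adjoint_mat (X s) = V ** adjoint_mat (R s) ** adjoint_mat U" for s
    by (simp add: X adjoint_mat_mult matrix_mul_assoc)
  have conjV: "trace (V ** B ** adjoint_mat V) = trace B" for B
    using V by (subst trace_mul_sym) (simp add: matrix_mul_assoc)
  have q_sym: "q i j k = q k j i" for i j k
  proof -
    have "cnj (C $ i $ j) * K $ i $ k * C $ k $ j = cnj (cnj (C $ k $ j) * K $ k $ i * C $ i $ j)"
      using self_adjoint_nth[OF K, of k i] by (simp add: mult_ac)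
    then show ?thesis unfolding q_def by (metis cnj.sel(1))
  qed
  have 1: "Re (trace (adjoint_mat (X s) ** T)) = (\<Sum>i\<in>UNIV. \<Sum>j\<in>UNIV. \<Sum>k\<in>UNIV. q i j k * r s i j)" for s
  proof -
    have "adjoint_mat (X s) ** T = V ** (adjoint_mat (R s) ** (K ** C)) ** adjoint_mat V"
      using U V by (simp add: adj C_def TK matrix_mul_assoc)
    then have "trace (adjoint_mat (X s) ** T) = trace (adjoint_mat (R s) ** (K ** C))"
      by (simp add: conjV)
    also have "\<dots> = (\<Sum>i\<in>UNIV. \<Sum>j\<in>UNIV. \<Sum>k\<in>UNIV. (cnj (C $ i $ j) * K $ i $ k * C $ k $ j) * complex_of_real (r s i j))"
      unfolding trace_adjoint_mult by (simp add: R_def matrix_matrix_mult_def sum_distrib_left mult_ac)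
    finally show ?thesis by (simp add: q_def)
  qed
  \<comment> \<open>Exchanging \<open>i\<close> and \<open>k\<close> by \<open>q_sym\<close>
    rewrites the same trace with \<open>r s k j\<close>. Adding both forms produces the symmetric
    integrand of \<open>has_integral_log_kernel\<close>.\<close>
  have 2: "Re (trace (adjoint_mat (X s) ** T)) = (\<Sum>i\<in>UNIV. \<Sum>j\<in>UNIV. \<Sum>k\<in>UNIV. q i j k * r s k j)" for s
  proof -
    have "(\<Sum>i\<in>UNIV. \<Sum>j\<in>UNIV. \<Sum>k\<in>UNIV. q i j k * r s i j) = (\<Sum>i\<in>UNIV. \<Sum>k\<in>UNIV. \<Sum>j\<in>UNIV. q i j k * r s i j)"
      by (intro sum.cong refl sum.swap)
    also have "\<dots> = (\<Sum>k\<in>UNIV. \<Sum>i\<in>UNIV. \<Sum>j\<in>UNIV. q i j k * r s i j)"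
      by (rule sum.swap)
    also have "\<dots> = (\<Sum>k\<in>UNIV. \<Sum>j\<in>UNIV. \<Sum>i\<in>UNIV. q k j i * r s i j)"
      by (subst q_sym) (intro sum.cong refl sum.swap)
    finally show ?thesis unfolding 1 .
  qed
  have 3: "Re (trace (adjoint_mat (X s) ** (T ** X s))) = (\<Sum>i\<in>UNIV. \<Sum>j\<in>UNIV. \<Sum>k\<in>UNIV. q i j k * (r s i j * r s k j))" for s
  proof -
    have "adjoint_mat (X s) ** (T ** X s) = V ** (adjoint_mat (R s) ** (K ** R s)) ** adjoint_mat V"
      using U V by (simp add: adj TK matrix_mul_assoc) (simp add: X matrix_mul_assoc U)
    then have "trace (adjoint_mat (X s) ** (T ** X s)) = trace (adjoint_mat (R s) ** (K ** R s))"
      by (simp add: conjV)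
    also have "\<dots> = (\<Sum>i\<in>UNIV. \<Sum>j\<in>UNIV. \<Sum>k\<in>UNIV. (cnj (C $ i $ j) * K $ i $ k * C $ k $ j) * complex_of_real (r s i j * r s k j))"
      unfolding trace_adjoint_mult by (simp add: R_def matrix_matrix_mult_def sum_distrib_left mult_ac)
    finally show ?thesis by (simp add: q_def del: of_real_mult)
  qed
  have "((\<lambda>s. \<Sum>i\<in>UNIV. \<Sum>j\<in>UNIV. \<Sum>k\<in>UNIV. q i j k * ((1 - s) * (r s i j + r s k j - s * (r s i j * r s k j))))
    has_integral (\<Sum>i\<in>UNIV. \<Sum>j\<in>UNIV. \<Sum>k\<in>UNIV. q i j k * (log_kernel (t i) (t k) - ln (a j)))) {0..1}"
    unfolding r_def by (intro has_integral_sum has_integral_mult_right has_integral_log_kernel t a finite)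
  moreover have "(\<lambda>s. \<Sum>i\<in>UNIV. \<Sum>j\<in>UNIV. \<Sum>k\<in>UNIV. q i j k * ((1 - s) * (r s i j + r s k j - s * (r s i j * r s k j))))
    = (\<lambda>s. (1 - s) * (2 * Re (trace (adjoint_mat (X s) ** T)) - s * Re (trace (adjoint_mat (X s) ** (T ** X s)))))"
  proof
    fix s
    have "2 * Re (trace (adjoint_mat (X s) ** T))
      = (\<Sum>i\<in>UNIV. \<Sum>j\<in>UNIV. \<Sum>k\<in>UNIV. q i j k * r s i j) + (\<Sum>i\<in>UNIV. \<Sum>j\<in>UNIV. \<Sum>k\<in>UNIV. q i j k * r s k j)"
      using 1[of s] 2[of s] by linarith
    then show "(\<Sum>i\<in>UNIV. \<Sum>j\<in>UNIV. \<Sum>k\<in>UNIV. q i j k * ((1 - s) * (r s i j + r s k j - s * (r s i j * r s k j))))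
      = (1 - s) * (2 * Re (trace (adjoint_mat (X s) ** T)) - s * Re (trace (adjoint_mat (X s) ** (T ** X s))))"
      unfolding 3 by (simp only: sum_distrib_left sum.distrib[symmetric] sum_subtractf[symmetric])
        (simp add: algebra_simps)
  qed
  moreover have "(\<Sum>i\<in>UNIV. \<Sum>j\<in>UNIV. \<Sum>k\<in>UNIV. q i j k * (log_kernel (t i) (t k) - ln (a j)))
    = Re (trace (T ** (conj_diag U (ln \<circ> t) - conj_diag V (ln \<circ> a))))"
  proof -
    \<comment> \<open>\<open>C\<close> is unitary, so summing over \<open>j\<close> leaves only
      \<open>i = k\<close>, where \<open>log_kernel\<close> is the plain logarithm; the divided
      differences at \<open>i \<noteq> k\<close> drop out.\<close>
    have CC: "(\<Sum>j\<in>UNIV. q i j k) = (if i = k then Re (K $ i $ i) else 0)" for i k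
    proof -
      have "C ** adjoint_mat C = mat 1"
        using U V by (simp add: C_def adjoint_mat_mult matrix_mul_assoc)
      then have "(C ** adjoint_mat C) $ k $ i = (if i = k then 1 else 0)"
        by (simp add: mat_def)
      then have *: "(\<Sum>j\<in>UNIV. C $ k $ j * cnj (C $ i $ j)) = (if i = k then 1 else 0)"
        by (simp add: matrix_matrix_mult_def)
      have "(\<Sum>j\<in>UNIV. q i j k) = Re (K $ i $ k * (\<Sum>j\<in>UNIV. C $ k $ j * cnj (C $ i $ j)))"
        by (simp add: q_def sum_distrib_left mult_ac del: times_complex.simps)
      then show ?thesis unfolding * by simp
    qed
    have "trace (T ** conj_diag U (ln \<circ> t)) = trace (U ** (K ** diag_mat (ln \<circ> t) ** adjoint_mat U))"
      using U by (simp add: TK matrix_mul_assoc)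
    also have "\<dots> = trace (K ** diag_mat (ln \<circ> t))"
      using U by (subst trace_mul_sym) (simp add: matrix_mul_assoc)
    finally have "Re (trace (T ** conj_diag U (ln \<circ> t))) = (\<Sum>i\<in>UNIV. Re (K $ i $ i) * ln (t i))"
      by (simp add: trace_def diag_mat_mult_nth)
    also have "\<dots> = (\<Sum>i\<in>UNIV. \<Sum>k\<in>UNIV. (\<Sum>j\<in>UNIV. q i j k) * log_kernel (t i) (t k))"
      unfolding CC by (simp add: if_distrib if_distribR log_kernel_def cong: if_cong)
    also have "\<dots> = (\<Sum>i\<in>UNIV. \<Sum>k\<in>UNIV. \<Sum>j\<in>UNIV. q i j k * log_kernel (t i) (t k))"
      by (simp add: sum_distrib_right)
    also have "\<dots> = (\<Sum>i\<in>UNIV. \<Sum>j\<in>UNIV. \<Sum>k\<in>UNIV. q i j k * log_kernel (t i) (t k))"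
      by (intro sum.cong refl sum.swap)
    finally have 5: "Re (trace (T ** conj_diag U (ln \<circ> t))) = \<dots>" .
    have "trace (T ** conj_diag V (ln \<circ> a)) = trace (U ** (K ** (C ** diag_mat (ln \<circ> a) ** adjoint_mat V)))"
      by (simp add: TK C_def matrix_mul_assoc)
    also have "\<dots> = trace ((K ** (C ** diag_mat (ln \<circ> a))) ** adjoint_mat C)"
      by (subst trace_mul_sym) (simp add: matrix_mul_assoc C_def adjoint_mat_mult)
    also have "\<dots> = trace (adjoint_mat C ** (K ** (C ** diag_mat (ln \<circ> a))))"
      by (rule trace_mul_sym)
    also have "\<dots> = (\<Sum>i\<in>UNIV. \<Sum>j\<in>UNIV. \<Sum>k\<in>UNIV. (cnj (C $ i $ j) * K $ i $ k * C $ k $ j) * complex_of_real (ln (a j)))"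
      unfolding trace_adjoint_mult matrix_matrix_mult_def[of K] diag_mat_mult_nth 
      by (simp add: diag_mat_mult_nth sum_distrib_left mult_ac)
    finally have "Re (trace (T ** conj_diag V (ln \<circ> a))) = (\<Sum>i\<in>UNIV. \<Sum>j\<in>UNIV. \<Sum>k\<in>UNIV. q i j k * ln (a j))"
      by (simp add: q_def)
    with 5 show ?thesis
      by (simp add: matrix_mult_diff_right trace_sub right_diff_distrib sum_subtractf)
  qed
  ultimately show ?thesis by simp
qed

text \<open>The scalar formula, summed with the overlap weights, gives the relative entropy
  \<open>tr (T ln T - T ln A - T + A)\<close>. The integrand is \<open>1 - s\<close> times the
  maximum of \<open>resolvent_form\<close>.\<close>

lemma has_integral_trace_relative_entropy:
  assumes U: "unitary_mat U" and V: "unitary_mat V" and t: "\<And>i. t i > 0" and a: "\<And>j. a j > 0"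
  shows "((\<lambda>s. (1 - s) * (\<Sum>i\<in>UNIV. \<Sum>j\<in>UNIV. (cmod ((adjoint_mat U ** V) $ i $ j))\<^sup>2 * ((t i - a j)\<^sup>2 / (a j + s * (t i - a j)))))
    has_integral (Re (trace (conj_diag U t ** (conj_diag U (ln \<circ> t) - conj_diag V (ln \<circ> a))))
      - Re (trace (conj_diag U t)) + Re (trace (conj_diag V a)))) {0..1}"
proof -
  define w where "w = (\<lambda>i j. (cmod ((adjoint_mat U ** V) $ i $ j))\<^sup>2)"
  have tr: "Re (trace (conj_diag U l ** conj_diag V m)) = (\<Sum>i\<in>UNIV. \<Sum>j\<in>UNIV. l i * m j * w i j)" for l m
    by (simp add: trace_conj_diag_mult w_def)
  have "((\<lambda>s. \<Sum>i\<in>UNIV. \<Sum>j\<in>UNIV. w i j * ((1 - s) * ((t i - a j)\<^sup>2 / (a j + s * (t i - a j)))))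
    has_integral (\<Sum>i\<in>UNIV. \<Sum>j\<in>UNIV. w i j * (t i * ln (t i) - t i * ln (a j) - t i + a j))) {0..1}"
    by (intro has_integral_sum has_integral_mult_right has_integral_relative_entropy t a finite)
  moreover have "(\<Sum>i\<in>UNIV. \<Sum>j\<in>UNIV. w i j * (t i * ln (t i) - t i * ln (a j) - t i + a j))
    = Re (trace (conj_diag U t ** (conj_diag U (ln \<circ> t) - conj_diag V (ln \<circ> a))))
      - Re (trace (conj_diag U t)) + Re (trace (conj_diag V a))"
  proof -
    \<comment> \<open>Inserting the identity as a \<open>conj_diag\<close> with constant eigenvalue
      \<open>1\<close> turns traces of a single matrix into double sums with the same
      weights.\<close>
    have "Re (trace (conj_diag U t ** conj_diag U (ln \<circ> t))) = (\<Sum>i\<in>UNIV. \<Sum>j\<in>UNIV. t i * ln (t i) * 1 * w i j)"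
      using tr[of "\<lambda>i. t i * ln (t i)" "\<lambda>_. 1"] unfolding conj_diag_one[OF V]
      by (simp add: conj_diag_mult[OF U])
    moreover have "Re (trace (conj_diag U t)) = (\<Sum>i\<in>UNIV. \<Sum>j\<in>UNIV. t i * 1 * w i j)"
      using tr[of t "\<lambda>_. 1"] unfolding conj_diag_one[OF V] by simp
    moreover have "Re (trace (conj_diag V a)) = (\<Sum>i\<in>UNIV. \<Sum>j\<in>UNIV. 1 * a j * w i j)"
      using tr[of "\<lambda>_. 1" a] unfolding conj_diag_one[OF U] by simp
    moreover have "Re (trace (conj_diag U t ** conj_diag V (ln \<circ> a))) = (\<Sum>i\<in>UNIV. \<Sum>j\<in>UNIV. t i * ln (a j) * w i j)"
      using tr[of t "ln \<circ> a"] by simp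
    ultimately show ?thesis
      unfolding matrix_mult_diff_right trace_sub minus_complex.sel
      by (simp only: sum_subtractf[symmetric] sum.distrib[symmetric]) (simp add: algebra_simps)
  qed
  ultimately show ?thesis
    by (simp add: w_def sum_distrib_left mult_ac)
qed

text \<open>Lieb's theorem in tangent form: \<open>A \<mapsto> tr exp (H + log A)\<close> is homogeneous of degree one and lies
  below a linear functional that touches it at \<open>conj_diag V a\<close>. With \<open>T = exp (H + log A)\<close> one has
  \<open>tr T = tr (T H) + tr A - D(T; A)\<close>, and the \<open>T\<close>-part of the tangent functional of the relative entropy
  \<open>D\<close> cancels \<open>tr (T H)\<close>.\<close>

theorem lieb_tangent:
  fixes H V :: "complex^'d^'d"
  assumes H: "self_adjoint H" and V: "unitary_mat V" and a: "\<And>j. a j > 0"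
  shows "\<exists>L. bounded_linear L \<and>
    (\<forall>W b. unitary_mat W \<longrightarrow> (\<forall>j. 0 < b j) \<longrightarrow>
       Re (trace (mat_fun exp (H + conj_diag W (ln \<circ> b)))) \<le> L (conj_diag W b)) \<and>
    Re (trace (mat_fun exp (H + conj_diag V (ln \<circ> a)))) = L (conj_diag V a)"
proof -
  \<comment> \<open>\<open>exp (H + K)\<close> is written with positive eigenvalues \<open>t\<close>
    whose logarithms give back \<open>H + K\<close>.\<close>
  have ex: "\<exists>U t. unitary_mat U \<and> (\<forall>i. 0 < t i) \<and> conj_diag U (ln \<circ> t) = H + K \<and> mat_fun exp (H + K) = conj_diag U t"
    if K: "self_adjoint K" for K
  proof -
    obtain U h where U: "unitary_mat U" "H + K = conj_diag U h"
      using spectral_theorem self_adjoint_add[OF H K] by blast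
    moreover have "ln \<circ> (exp \<circ> h) = h"
      by (simp add: fun_eq_iff)
    ultimately show ?thesis
      by (intro exI[of _ U] exI[of _ "exp \<circ> h"]) (simp add: mat_fun_conj_diag)
  qed
  obtain U t where U: "unitary_mat U" and t: "\<And>i. 0 < t i"
    and Ut: "conj_diag U (ln \<circ> t) = H + conj_diag V (ln \<circ> a)"
    and Te: "mat_fun exp (H + conj_diag V (ln \<circ> a)) = conj_diag U t"
    using ex[OF self_adjoint_conj_diag] by blast
  define X where "X = opt_matrix U t V a"
  \<comment> \<open>The part of \<open>(1 - s) * resolvent_form s (X s) T A\<close> that depends on
    \<open>A\<close>. It is linear in \<open>A\<close> because \<open>X\<close> stays frozen at the
    reference point.\<close>
  define g where "g = (\<lambda>A s. (1 - s) * (- 2 * Re (trace (adjoint_mat (X s) ** A)) - (1 - s) * Re (trace (adjoint_mat (X s) ** (X s ** A)))))"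
  have cX: "continuous_on {0..1} X"
    unfolding X_def by (intro continuous_on_opt_matrix t a)
  have int: "g A integrable_on {0..1}" for A
    unfolding g_def
    by (intro integrable_continuous_real continuous_intros continuous_on_trace_intros cX)
  define \<Phi> where "\<Phi> A = integral {0..1} (g A)" for A
  have lin: "linear \<Phi>"
  proof (rule linearI)
    fix A B :: "complex^'d^'d" and c :: real
    have "g (A + B) = (\<lambda>s. g A s + g B s)"
      unfolding g_def by (simp add: fun_eq_iff matrix_add_ldistrib trace_add algebra_simps)
    then show "\<Phi> (A + B) = \<Phi> A + \<Phi> B"
      unfolding \<Phi>_def by (simp add: Henstock_Kurzweil_Integration.integral_add[OF int int])
    have "g (c *\<^sub>R A) = (\<lambda>s. c * g A s)"
      unfolding g_def by (simp add: fun_eq_iff matrix_mult_scaleR_right trace_scaleR algebra_simps)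
    then show "\<Phi> (c *\<^sub>R A) = c *\<^sub>R \<Phi> A"
      unfolding \<Phi>_def by simp
  qed
  define L where "L A = Re (trace A) - \<Phi> A" for A
  have "linear (\<lambda>A::complex^'d^'d. Re (trace A))"
    by (rule linearI) (simp_all add: trace_add trace_scaleR)
  then have "bounded_linear L"
    unfolding L_def linear_conv_bounded_linear[symmetric] using lin by (rule linear_compose_sub)
  \<comment> \<open>At the reference point the two logarithms differ by \<open>H\<close>, so the
    \<open>T\<close>-part integrates to \<open>tr (T H)\<close> for every self-adjoint
    \<open>T\<close>.\<close>
  have split: "((\<lambda>s. (1 - s) * resolvent_form s (X s) T A) has_integral Re (trace (T ** H)) + \<Phi> A) {0..1}"
    if "self_adjoint T" for T A
  proof -
    have "((\<lambda>s. (1 - s) * (2 * Re (trace (adjoint_mat (X s) ** T)) - s * Re (trace (adjoint_mat (X s) ** (T ** X s)))) + g A s)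
      has_integral Re (trace (T ** (conj_diag U (ln \<circ> t) - conj_diag V (ln \<circ> a)))) + \<Phi> A) {0..1}"
      unfolding X_def
      by (intro has_integral_add has_integral_opt_matrix U V t a that)
         (use int in \<open>auto simp: \<Phi>_def X_def[symmetric]\<close>)
    then show ?thesis
      unfolding Ut g_def resolvent_form_def by (simp add: matrix_mult_diff_right trace_sub algebra_simps)
  qed
  have le: "Re (trace (mat_fun exp (H + conj_diag W (ln \<circ> b)))) \<le> L (conj_diag W b)"
    if W: "unitary_mat W" and b: "\<And>j. 0 < b j" for W b
  proof -
    obtain P p where P: "unitary_mat P" and p: "\<And>i. 0 < p i"
      and Pp: "conj_diag P (ln \<circ> p) = H + conj_diag W (ln \<circ> b)"
      and Pe: "mat_fun exp (H + conj_diag W (ln \<circ> b)) = conj_diag P p"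
      using ex[OF self_adjoint_conj_diag] by blast
    \<comment> \<open>Here \<open>X\<close> is only a trial matrix, so the integral is at most the
      relative entropy of the new pair. The new logarithms differ by \<open>H\<close> too; hence
      \<open>tr (T H)\<close> cancels and a bound on \<open>tr T\<close> remains.\<close>
    have "Re (trace (conj_diag P p ** H)) + \<Phi> (conj_diag W b)
      \<le> Re (trace (conj_diag P p ** (conj_diag P (ln \<circ> p) - conj_diag W (ln \<circ> b)))) - Re (trace (conj_diag P p)) + Re (trace (conj_diag W b))"
      by (rule has_integral_le[OF split[OF self_adjoint_conj_diag] has_integral_trace_relative_entropy[OF P W p b]])
         (intro mult_left_mono resolvent_form_le P W p b, auto)
    then show ?thesis
      unfolding Pp Pe L_def by simp
  qed
  \<comment> \<open>At the reference point \<open>X s\<close> is the maximizer for each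
    \<open>s\<close>, so the same chain holds with equality.\<close>
  have "Re (trace (conj_diag U t ** H)) + \<Phi> (conj_diag V a)
    = Re (trace (conj_diag U t ** (conj_diag U (ln \<circ> t) - conj_diag V (ln \<circ> a)))) - Re (trace (conj_diag U t)) + Re (trace (conj_diag V a))"
  proof (rule has_integral_unique[OF has_integral_eq[OF _ split[OF self_adjoint_conj_diag]] has_integral_trace_relative_entropy[OF U V t a]])
  qed (simp add: X_def resolvent_form_opt_matrix[OF U V t a])
  then have "Re (trace (mat_fun exp (H + conj_diag V (ln \<circ> a)))) = L (conj_diag V a)"
    unfolding Ut Te L_def by simp
  with \<open>bounded_linear L\<close> le show ?thesis by blast
qed

subsection \<open>Random matrices\<close>

lemma borel_measurable_trace_exp:
  "(\<lambda>A::complex^'d^'d. Re (trace (mat_fun exp (herm_part A)))) \<in> borel_measurable borel"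
proof -
  have "(\<lambda>A::complex^'d^'d. Re (trace A)) \<in> borel_measurable borel"
    by (intro borel_measurable_continuous_onI continuous_on_Re_trace continuous_on_id)
  from measurable_compose[OF borel_measurable_mat_fun[OF continuous_on_exp[OF continuous_on_id]] this]
  show ?thesis by simp
qed

text \<open>Tonelli and induction: with the other coordinates fixed, integrating out coordinate
  \<open>i\<close> replaces \<open>G i\<close> by the constant \<open>L i\<close>, which then joins
  \<open>H\<close>. For this reason \<open>H\<close> varies in the induction.\<close>

lemma nn_integral_trace_exp_PiM:
  fixes G :: "nat \<Rightarrow> complex^'d^'d \<Rightarrow> complex^'d^'d"
  assumes N: "\<And>i. prob_space (N i)" "\<And>i. sets (N i) = sets borel"
    and G: "\<And>i. G i \<in> borel_measurable borel" "\<And>i y. self_adjoint (G i y)"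
    and L: "\<And>i. self_adjoint (L i)"
    and I: "finite I"
    and le: "\<And>i K. i \<in> I \<Longrightarrow> self_adjoint K \<Longrightarrow>
      (\<integral>\<^sup>+y. ennreal (Re (trace (mat_fun exp (K + G i y)))) \<partial>N i) \<le> ennreal (Re (trace (mat_fun exp (K + L i))))"
    and H: "self_adjoint H"
  shows "(\<integral>\<^sup>+x. ennreal (Re (trace (mat_fun exp (H + (\<Sum>i\<in>I. G i (x i)))))) \<partial>PiM I N)
    \<le> ennreal (Re (trace (mat_fun exp (H + (\<Sum>i\<in>I. L i)))))"
  using I le H
proof (induction I arbitrary: H rule: finite_induct)
  case empty
  show ?case by (simp add: PiM_empty nn_integral_count_space_finite)
next
  case (insert i I)
  interpret product_sigma_finite N
    by (rule product_sigma_finite.intro) (rule prob_space_imp_sigma_finite[OF N(1)])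
  have sa: "self_adjoint (H + (\<Sum>j\<in>J. G j (x j)))" for x J
    by (intro self_adjoint_add self_adjoint_sum G insert.prems)
  have meas: "(\<lambda>x. ennreal (Re (trace (mat_fun exp (H + (\<Sum>j\<in>insert i I. G j (x j)))))))
      \<in> borel_measurable (PiM (insert i I) N)"
  proof -
    have "(\<lambda>x. G j (x j)) \<in> borel_measurable (PiM (insert i I) N)" if "j \<in> insert i I" for j
      using measurable_compose[OF measurable_component_singleton[OF that, of N], of "G j" borel] G(1)[of j]
      by (simp add: measurable_cong_sets[OF N(2) refl])
    then have "(\<lambda>x. H + (\<Sum>j\<in>insert i I. G j (x j))) \<in> borel_measurable (PiM (insert i I) N)"
      by (intro borel_measurable_add borel_measurable_sum borel_measurable_const)
    from measurable_compose[OF this borel_measurable_trace_exp] show ?thesis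
      unfolding herm_part_self_adjoint[OF sa] by (rule measurable_compose[OF _ measurable_ennreal])
  qed
  have "(\<integral>\<^sup>+x. ennreal (Re (trace (mat_fun exp (H + (\<Sum>j\<in>insert i I. G j (x j)))))) \<partial>PiM (insert i I) N)
    = (\<integral>\<^sup>+x. \<integral>\<^sup>+y. ennreal (Re (trace (mat_fun exp ((H + (\<Sum>j\<in>I. G j (x j))) + G i y)))) \<partial>N i \<partial>PiM I N)"
  proof (subst product_nn_integral_insert[OF insert.hyps meas], intro nn_integral_cong)
    fix x y
    have "(\<Sum>j\<in>I. G j ((x(i := y)) j)) = (\<Sum>j\<in>I. G j (x j))"
      using insert.hyps by (intro sum.cong) auto
    then show "ennreal (Re (trace (mat_fun exp (H + (\<Sum>j\<in>insert i I. G j ((x(i := y)) j))))))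
      = ennreal (Re (trace (mat_fun exp (H + (\<Sum>j\<in>I. G j (x j)) + G i y))))"
      using insert.hyps by (simp add: add_ac)
  qed
  also have "\<dots> \<le> (\<integral>\<^sup>+x. ennreal (Re (trace (mat_fun exp ((H + (\<Sum>j\<in>I. G j (x j))) + L i)))) \<partial>PiM I N)"
    by (intro nn_integral_mono insert.prems sa) simp
  also have "\<dots> = (\<integral>\<^sup>+x. ennreal (Re (trace (mat_fun exp ((H + L i) + (\<Sum>j\<in>I. G j (x j)))))) \<partial>PiM I N)"
    by (simp add: add_ac)
  also have "\<dots> \<le> ennreal (Re (trace (mat_fun exp ((H + L i) + (\<Sum>j\<in>I. L j)))))"
    by (intro insert.IH insert.prems self_adjoint_add L) auto
  finally show ?case using insert.hyps by (simp add: add_ac)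
qed

text \<open>Independence makes the joint law of the \<open>Y i\<close> a product measure, to which
  \<open>nn_integral_trace_exp_PiM\<close> applies.\<close>

lemma (in prob_space) nn_integral_trace_exp_indep:
  fixes G :: "nat \<Rightarrow> complex^'d^'d \<Rightarrow> complex^'d^'d"
  assumes Y: "indep_vars (\<lambda>_. borel) Y I" and I: "finite I" "I \<noteq> {}"
    and G: "\<And>i. G i \<in> borel_measurable borel" "\<And>i y. self_adjoint (G i y)"
    and L: "\<And>i. self_adjoint (L i)"
    and le: "\<And>i K. i \<in> I \<Longrightarrow> self_adjoint K \<Longrightarrow>
      (\<integral>\<^sup>+\<omega>. ennreal (Re (trace (mat_fun exp (K + G i (Y i \<omega>))))) \<partial>M) \<le> ennreal (Re (trace (mat_fun exp (K + L i))))"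
    and H: "self_adjoint H"
  shows "(\<integral>\<^sup>+\<omega>. ennreal (Re (trace (mat_fun exp (H + (\<Sum>i\<in>I. G i (Y i \<omega>)))))) \<partial>M)
    \<le> ennreal (Re (trace (mat_fun exp (H + (\<Sum>i\<in>I. L i)))))"
proof -
  have rv: "random_variable borel (Y i)" if "i \<in> I" for i
    using Y that by (auto simp: indep_vars_def)
  \<comment> \<open>The point mass at \<open>0\<close> is a filler outside \<open>I\<close>, so that
    every \<open>N i\<close> is a probability measure.\<close>
  define N where "N = (\<lambda>i. if i \<in> I then distr M borel (Y i) else return borel 0)"
  have N: "prob_space (N i)" "sets (N i) = sets borel" for i
    unfolding N_def by (auto intro!: prob_space_distr rv prob_space_return)
  have sa: "self_adjoint (K + G i y)" if "self_adjoint K" for K i y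
    using that G by (intro self_adjoint_add)
  have meas: "(\<lambda>y. ennreal (Re (trace (mat_fun exp (K + G i y))))) \<in> borel_measurable borel"
    if "self_adjoint K" for K i
  proof -
    have "(\<lambda>y. K + G i y) \<in> borel_measurable borel"
      using G(1) by (intro borel_measurable_add borel_measurable_const)
    from measurable_compose[OF this borel_measurable_trace_exp] show ?thesis
      unfolding herm_part_self_adjoint[OF sa[OF that]] by (rule measurable_compose[OF _ measurable_ennreal])
  qed
  have saH: "self_adjoint (H + (\<Sum>i\<in>I. G i (x i)))" for x
    by (intro self_adjoint_add self_adjoint_sum G H)
  have measH: "(\<lambda>x. ennreal (Re (trace (mat_fun exp (H + (\<Sum>i\<in>I. G i (x i)))))))
      \<in> borel_measurable (PiM I (\<lambda>_. borel))"
  proof -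
    have "(\<lambda>x. H + (\<Sum>j\<in>I. G j (x j))) \<in> borel_measurable (PiM I (\<lambda>_. borel))"
      using G(1) by (intro borel_measurable_add borel_measurable_sum borel_measurable_const)
        (auto intro: measurable_compose[OF measurable_component_singleton])
    from measurable_compose[OF this borel_measurable_trace_exp] show ?thesis
      unfolding herm_part_self_adjoint[OF saH] by (rule measurable_compose[OF _ measurable_ennreal])
  qed
  have "(\<integral>\<^sup>+\<omega>. ennreal (Re (trace (mat_fun exp (H + (\<Sum>i\<in>I. G i (Y i \<omega>)))))) \<partial>M)
    = (\<integral>\<^sup>+x. ennreal (Re (trace (mat_fun exp (H + (\<Sum>i\<in>I. G i (x i)))))) \<partial>distr M (PiM I (\<lambda>_. borel)) (\<lambda>\<omega>. \<lambda>i\<in>I. Y i \<omega>))"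
    by (subst nn_integral_distr) (auto intro!: measH measurable_restrict rv)
  also have "distr M (PiM I (\<lambda>_. borel)) (\<lambda>\<omega>. \<lambda>i\<in>I. Y i \<omega>) = PiM I (\<lambda>i. distr M borel (Y i))"
    using indep_vars_iff_distr_eq_PiM'[of I Y "\<lambda>_. borel"] I Y rv by auto
  also have "\<dots> = PiM I N"
    by (intro PiM_cong) (auto simp: N_def)
  also have "(\<integral>\<^sup>+x. ennreal (Re (trace (mat_fun exp (H + (\<Sum>i\<in>I. G i (x i)))))) \<partial>PiM I N)
    \<le> ennreal (Re (trace (mat_fun exp (H + (\<Sum>i\<in>I. L i)))))"
  proof (rule nn_integral_trace_exp_PiM[OF N G L I(1) _ H])
    fix i and K :: "complex^'d^'d" assume "i \<in> I" "self_adjoint K"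
    then show "(\<integral>\<^sup>+y. ennreal (Re (trace (mat_fun exp (K + G i y)))) \<partial>N i) \<le> ennreal (Re (trace (mat_fun exp (K + L i))))"
      using le by (simp add: N_def nn_integral_distr rv meas)
  qed
  finally show ?thesis .
qed

section \<open>Integrability and expectation of random matrices\<close>

lemma integrable_matrix:
  fixes Y :: "'a \<Rightarrow> complex^'d^'d"
  assumes Y: "Y \<in> borel_measurable M" and int: "\<And>i k. integrable M (\<lambda>\<omega>. Y \<omega> $ i $ k)"
  shows "integrable M Y"
proof (rule Bochner_Integration.integrable_bound)
  show "integrable M (\<lambda>\<omega>. \<Sum>i\<in>UNIV. \<Sum>k\<in>UNIV. cmod (Y \<omega> $ i $ k))"
    by (intro Bochner_Integration.integrable_sum integrable_norm int)
  have "norm A \<le> (\<Sum>i\<in>UNIV. \<Sum>k\<in>UNIV. cmod (A $ i $ k))" for A :: "complex^'d^'d"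
  proof -
    have "norm A \<le> (\<Sum>i\<in>UNIV. norm (A $ i))"
      unfolding norm_vec_def[of A] by (rule L2_set_le_sum) simp
    also have "\<dots> \<le> (\<Sum>i\<in>UNIV. \<Sum>k\<in>UNIV. cmod (A $ i $ k))"
      by (intro sum_mono, subst norm_vec_def) (rule L2_set_le_sum, simp)
    finally show ?thesis .
  qed
  then show "AE \<omega> in M. norm (Y \<omega>) \<le> norm (\<Sum>i\<in>UNIV. \<Sum>k\<in>UNIV. cmod (Y \<omega> $ i $ k))"
    by (intro AE_I2) (auto intro: order_trans[OF _ abs_ge_self])
qed (fact Y)

text \<open>The link to the Bochner integral, which commutes with bounded linear maps such as
  quadratic forms.\<close>

lemma mat_expectation_eq_integral:
  assumes "integrable M Y"
  shows "mat_expectation M Y = (\<integral>\<omega>. Y \<omega> \<partial>M)"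
proof -
  have "bounded_linear (\<lambda>A::complex^'d^'d. A $ i $ k)" for i k
    by (rule bounded_linear_compose[OF bounded_linear_vec_nth bounded_linear_vec_nth])
  then show ?thesis
    unfolding mat_expectation_def vec_eq_iff vec_lambda_beta
    using integral_bounded_linear assms by blast
qed

lemma matrix_vector_scaleR_left: "(c *\<^sub>R A) *v x = c *\<^sub>R ((A::complex^'d^'d) *v x)"
  by (simp add: vec_eq_iff matrix_vector_mult_def scaleR_right.sum)

lemma self_adjoint_mat_expectation:
  assumes "\<And>\<omega>. \<omega> \<in> space M \<Longrightarrow> self_adjoint (Z \<omega>)"
  shows "self_adjoint (mat_expectation M Z)"
proof -
  have "(\<integral>\<omega>. cnj (Z \<omega> $ j $ i) \<partial>M) = (\<integral>\<omega>. Z \<omega> $ i $ j \<partial>M)" for i j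
    by (intro Bochner_Integration.integral_cong refl self_adjoint_nth assms)
  then show ?thesis by (simp add: self_adjoint_def vec_eq_iff mat_expectation_def)
qed

lemma bounded_linear_quadratic_form: "bounded_linear (\<lambda>A::complex^'d^'d. x \<bullet> (A *v x))"
  unfolding linear_conv_bounded_linear[symmetric]
  by (rule linearI) (simp_all add: matrix_vector_mult_add_rdistrib inner_add_right matrix_vector_scaleR_left)

lemma (in prob_space) integrable_square_integrable_matrix:
  fixes Y :: "'a \<Rightarrow> complex^'d^'d"
  assumes Y: "random_variable borel Y" and sq: "\<And>i k. integrable M (\<lambda>\<omega>. (cmod (Y \<omega> $ i $ k))\<^sup>2)"
  shows "integrable M Y" "integrable M (\<lambda>\<omega>. Y \<omega> ** Y \<omega>)"
proof -
  have meas: "random_variable borel (\<lambda>\<omega>. Y \<omega> $ i $ k)" for i k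
  proof -
    have "continuous_on UNIV (\<lambda>A::complex^'d^'d. A $ i $ k)"
      by (intro continuous_on_component continuous_on_id)
    from measurable_compose[OF Y borel_measurable_continuous_onI[OF this]] show ?thesis .
  qed
  have "integrable M (\<lambda>\<omega>. Y \<omega> $ i $ k)" for i k
  proof (rule Bochner_Integration.integrable_bound)
    show "integrable M (\<lambda>\<omega>. 1 + (cmod (Y \<omega> $ i $ k))\<^sup>2)"
      by (intro Bochner_Integration.integrable_add sq) simp
    have "u \<le> 1 + u\<^sup>2" for u :: real
      using sum_squares_bound[of u 1] by (smt (verit) power2_eq_square zero_le_square mult.right_neutral one_power2)
    then show "AE \<omega> in M. norm (Y \<omega> $ i $ k) \<le> norm (1 + (cmod (Y \<omega> $ i $ k))\<^sup>2)"
      by simp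
  qed (rule meas)
  then show "integrable M Y"
    by (rule integrable_matrix[OF Y])
  have YY: "random_variable borel (\<lambda>\<omega>. Y \<omega> ** Y \<omega>)"
    by (rule measurable_compose[OF Y borel_measurable_continuous_onI])
       (intro continuous_on_matrix_mult continuous_on_id)
  have "integrable M (\<lambda>\<omega>. Y \<omega> $ i $ j * Y \<omega> $ j $ k)" for i j k
  proof (rule Bochner_Integration.integrable_bound)
    show "integrable M (\<lambda>\<omega>. (cmod (Y \<omega> $ i $ j))\<^sup>2 + (cmod (Y \<omega> $ j $ k))\<^sup>2)"
      by (intro Bochner_Integration.integrable_add sq)
    have "u * v \<le> u\<^sup>2 + v\<^sup>2" if "0 \<le> u" "0 \<le> v" for u v :: real
      using sum_squares_bound[of u v] mult_nonneg_nonneg[OF that] by linarith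
    then show "AE \<omega> in M. norm (Y \<omega> $ i $ j * Y \<omega> $ j $ k) \<le> norm ((cmod (Y \<omega> $ i $ j))\<^sup>2 + (cmod (Y \<omega> $ j $ k))\<^sup>2)"
      by (simp add: norm_mult)
  qed (intro borel_measurable_times meas)
  then show "integrable M (\<lambda>\<omega>. Y \<omega> ** Y \<omega>)"
    by (intro integrable_matrix[OF YY]) (simp add: matrix_matrix_mult_def)
qed

section \<open>Exponential moments\<close>

text \<open>The polynomial is \<open>((1 + x)\<^sup>2 + 1) / 2\<close>. The uniform lower bound
  keeps its logarithm continuous and survives taking expectations.\<close>

lemma half_le_exp_taylor2: "1 / 2 \<le> 1 + x + x\<^sup>2 / 2" for x :: real
  using zero_le_power2[of "1 + x"] by (simp add: power2_sum)

text \<open>Jensen's inequality by a tangent. For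
  \<open>A = 1 + k Y + k\<^sup>2 Y\<^sup>2 / 2\<close>, the functional \<open>\<Lambda>\<close> of
  \<open>lieb_tangent\<close> at \<open>E A\<close> gives \<open>E tr exp (H + log A) \<le> E
  \<Lambda> A = \<Lambda> (E A) = tr exp (H + log (E A))\<close>. The witness
  \<open>L = log (E A)\<close> does not depend on \<open>H\<close>, and its bound is
  \<open>ln u \<le> u - 1\<close>.\<close>

lemma (in prob_space) nn_integral_trace_exp_log_le:
  fixes Y :: "'a \<Rightarrow> complex^'d^'d" and k :: real
  assumes Y: "random_variable borel Y" and sa: "\<And>\<omega>. \<omega> \<in> space M \<Longrightarrow> self_adjoint (Y \<omega>)"
    and sq: "\<And>i k. integrable M (\<lambda>\<omega>. (cmod (Y \<omega> $ i $ k))\<^sup>2)"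
  defines "g \<equiv> \<lambda>x. ln (1 + k * x + (k * x)\<^sup>2 / 2)"
  shows "\<exists>L. self_adjoint L \<and>
    (\<forall>H. self_adjoint H \<longrightarrow> (\<integral>\<^sup>+\<omega>. ennreal (Re (trace (mat_fun exp (H + mat_fun g (Y \<omega>))))) \<partial>M)
        \<le> ennreal (Re (trace (mat_fun exp (H + L))))) \<and>
    (\<forall>x. x \<bullet> (L *v x) \<le> x \<bullet> ((k *\<^sub>R mat_expectation M Y + (k\<^sup>2 / 2) *\<^sub>R mat_expectation M (\<lambda>\<omega>. Y \<omega> ** Y \<omega>)) *v x))"
proof -
  define h where "h = (\<lambda>x::real. 1 + k * x + (k * x)\<^sup>2 / 2)"
  have h: "h x \<ge> 1 / 2" for x
    unfolding h_def by (rule half_le_exp_taylor2)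
  define A where "A = (\<lambda>\<omega>. mat 1 + k *\<^sub>R Y \<omega> + (k\<^sup>2 / 2) *\<^sub>R (Y \<omega> ** Y \<omega>))"
  note int = integrable_square_integrable_matrix[OF Y sq]
  have intA: "integrable M A"
    unfolding A_def by (intro Bochner_Integration.integrable_add integrable_scaleR_right int) simp
  define EA where "EA = (\<integral>\<omega>. A \<omega> \<partial>M)"
  have EA: "EA = mat 1 + (k *\<^sub>R mat_expectation M Y + (k\<^sup>2 / 2) *\<^sub>R mat_expectation M (\<lambda>\<omega>. Y \<omega> ** Y \<omega>))"
    unfolding EA_def A_def using int
    by (simp add: Bochner_Integration.integral_add mat_expectation_eq_integral prob_space)
  have spec: "\<exists>W b. unitary_mat W \<and> (\<forall>j. 1 / 2 \<le> b j) \<and> A \<omega> = conj_diag W b \<and> mat_fun g (Y \<omega>) = conj_diag W (ln \<circ> b)"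
    if \<omega>: "\<omega> \<in> space M" for \<omega>
  proof -
    obtain W y where W: "unitary_mat W" "Y \<omega> = conj_diag W y"
      using spectral_theorem[OF sa[OF \<omega>]] .
    have "A \<omega> = conj_diag W (\<lambda>j. 1 + k * y j + k\<^sup>2 / 2 * (y j * y j))"
      unfolding A_def W(2) conj_diag_mult[OF W(1)] conj_diag_scaleR conj_diag_add
        conj_diag_one[OF W(1), symmetric] ..
    then have "A \<omega> = conj_diag W (h \<circ> y)"
      by (simp add: h_def comp_def power2_eq_square mult_ac)
    moreover have "mat_fun g (Y \<omega>) = conj_diag W (ln \<circ> (h \<circ> y))"
      unfolding W(2) mat_fun_conj_diag[OF W(1)] by (simp add: g_def h_def comp_def)
    ultimately show ?thesis
      using W h by (intro exI[of _ W] exI[of _ "h \<circ> y"]) simp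
  qed
  have "self_adjoint EA"
  proof -
    have "linear (adjoint_mat :: complex^'d^'d \<Rightarrow> _)"
      by (intro linearI adjoint_mat_add adjoint_mat_scaleR)
    then have "adjoint_mat EA = (\<integral>\<omega>. adjoint_mat (A \<omega>) \<partial>M)"
      unfolding EA_def linear_conv_bounded_linear using integral_bounded_linear intA by metis
    also have "\<dots> = EA"
      unfolding EA_def
      by (intro Bochner_Integration.integral_cong refl) (metis spec self_adjoint_conj_diag self_adjoint_def)
    finally show ?thesis by (simp add: self_adjoint_def)
  qed
  then obtain V a where V: "unitary_mat V" and EAV: "EA = conj_diag V a"
    using spectral_theorem by blast
  \<comment> \<open>All eigenvalues of every \<open>A \<omega>\<close> are at least
    \<open>1 / 2\<close>, hence so is its quadratic form at a unit vector. Integration transfers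
    this to \<open>EA\<close>, whose logarithm is therefore meaningful.\<close>
  have a: "a j > 0" for j
  proof -
    let ?v = "column j V"
    have "1 / 2 \<le> ?v \<bullet> (A \<omega> *v ?v)" if \<omega>: "\<omega> \<in> space M" for \<omega>
    proof -
      obtain W b where W: "unitary_mat W" "\<forall>j. 1 / 2 \<le> b j" "A \<omega> = conj_diag W b"
        using spec[OF \<omega>] by blast
      have "1 / 2 = (\<Sum>i\<in>UNIV. 1 / 2 * (cmod ((adjoint_mat W *v ?v) $ i))\<^sup>2)"
        using sum_cmod_unitary[OF W(1), of ?v] norm_column_unitary[OF V] by (simp flip: sum_divide_distrib)
      also have "\<dots> \<le> ?v \<bullet> (A \<omega> *v ?v)"
        unfolding W(3) inner_conj_diag using W(2) by (intro sum_mono mult_right_mono) auto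
      finally show ?thesis .
    qed
    then have "(\<integral>\<omega>. 1 / 2 \<partial>M) \<le> (\<integral>\<omega>. ?v \<bullet> (A \<omega> *v ?v) \<partial>M)"
      by (intro integral_mono integrable_bounded_linear[OF bounded_linear_quadratic_form intA]) auto
    also have "\<dots> = ?v \<bullet> (EA *v ?v)"
      unfolding EA_def by (rule integral_bounded_linear[OF bounded_linear_quadratic_form intA])
    also have "\<dots> = a j"
      using norm_column_unitary[OF V, of j] by (simp add: EAV conj_diag_column[OF V] norm_eq_1)
    finally show ?thesis by (simp add: prob_space)
  qed
  define L where "L = conj_diag V (ln \<circ> a)"
  have "(\<integral>\<^sup>+\<omega>. ennreal (Re (trace (mat_fun exp (H + mat_fun g (Y \<omega>))))) \<partial>M)
      \<le> ennreal (Re (trace (mat_fun exp (H + L))))" if H: "self_adjoint H" for H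
  proof -
    obtain \<Lambda> where lin: "bounded_linear \<Lambda>"
      and le: "\<forall>W b. unitary_mat W \<longrightarrow> (\<forall>j. 0 < b j) \<longrightarrow>
         Re (trace (mat_fun exp (H + conj_diag W (ln \<circ> b)))) \<le> \<Lambda> (conj_diag W b)"
      and eq: "Re (trace (mat_fun exp (H + L))) = \<Lambda> EA"
      using lieb_tangent[where a = a, OF H V a, folded L_def EAV] by (elim exE conjE) (rule that)
    have *: "0 \<le> Re (trace (mat_fun exp (H + mat_fun g (Y \<omega>))))"
      "Re (trace (mat_fun exp (H + mat_fun g (Y \<omega>)))) \<le> \<Lambda> (A \<omega>)" if \<omega>: "\<omega> \<in> space M" for \<omega>
    proof -
      obtain W b where W: "unitary_mat W" "\<forall>j. 1 / 2 \<le> b j" "A \<omega> = conj_diag W b" "mat_fun g (Y \<omega>) = conj_diag W (ln \<circ> b)"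
        using spec[OF \<omega>] by blast
      have "0 < b j" for j using W(2)[rule_format, of j] by linarith
      then show "Re (trace (mat_fun exp (H + mat_fun g (Y \<omega>)))) \<le> \<Lambda> (A \<omega>)"
        unfolding W(3,4) using le W(1) by blast
      show "0 \<le> Re (trace (mat_fun exp (H + mat_fun g (Y \<omega>))))"
        by (intro trace_exp_nonneg self_adjoint_add H self_adjoint_mat_fun sa \<omega>)
    qed
    have "(\<integral>\<^sup>+\<omega>. ennreal (Re (trace (mat_fun exp (H + mat_fun g (Y \<omega>))))) \<partial>M) \<le> (\<integral>\<^sup>+\<omega>. ennreal (\<Lambda> (A \<omega>)) \<partial>M)"
      by (intro nn_integral_mono ennreal_leI *(2))
    also have "\<dots> = ennreal (\<integral>\<omega>. \<Lambda> (A \<omega>) \<partial>M)"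
    proof (rule nn_integral_eq_integral)
      show "integrable M (\<lambda>\<omega>. \<Lambda> (A \<omega>))"
        by (rule integrable_bounded_linear[OF lin intA])
      show "AE \<omega> in M. 0 \<le> \<Lambda> (A \<omega>)"
        using * by (intro AE_I2) (rule order_trans)
    qed
    also have "(\<integral>\<omega>. \<Lambda> (A \<omega>) \<partial>M) = Re (trace (mat_fun exp (H + L)))"
      unfolding eq EA_def by (rule integral_bounded_linear[OF lin intA])
    finally show ?thesis .
  qed
  moreover have "x \<bullet> (L *v x) \<le> x \<bullet> ((k *\<^sub>R mat_expectation M Y + (k\<^sup>2 / 2) *\<^sub>R mat_expectation M (\<lambda>\<omega>. Y \<omega> ** Y \<omega>)) *v x)" for x
  proof -
    have "x \<bullet> (L *v x) \<le> x \<bullet> (conj_diag V (\<lambda>j. a j - 1) *v x)"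
      unfolding L_def inner_conj_diag comp_def by (intro sum_mono mult_right_mono ln_le_minus_one a) simp
    also have "conj_diag V (\<lambda>j. a j - 1) = EA - mat 1"
      unfolding EAV conj_diag_one[OF V, symmetric] conj_diag_diff ..
    finally show ?thesis by (simp add: EA)
  qed
  ultimately show ?thesis
    unfolding L_def using self_adjoint_conj_diag by blast
qed

text \<open>Once each summand is replaced by its \<open>L j\<close>, the bounds on the
  \<open>L j\<close> bring in first and second moments; the centering cancels the first
  moments.\<close>

lemma (in prob_space) integral_trace_exp_sum_log_le:
  fixes Y :: "nat \<Rightarrow> 'a \<Rightarrow> complex^'d^'d" and k :: real
  assumes indep: "indep_vars (\<lambda>_. borel) Y I" and I: "finite I" "I \<noteq> {}"
    and sa: "\<And>j \<omega>. j \<in> I \<Longrightarrow> \<omega> \<in> space M \<Longrightarrow> self_adjoint (Y j \<omega>)"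
    and sq: "\<And>j i k. j \<in> I \<Longrightarrow> integrable M (\<lambda>\<omega>. (cmod (Y j \<omega> $ i $ k))\<^sup>2)"
  defines "g \<equiv> \<lambda>x. ln (1 + k * x + (k * x)\<^sup>2 / 2)"
  defines "F \<equiv> \<lambda>\<omega>. Re (trace (mat_fun exp (\<Sum>j\<in>I. mat_fun g (Y j \<omega>) - k *\<^sub>R mat_expectation M (Y j))))"
    and "B \<equiv> Re (trace (mat_fun exp ((k\<^sup>2 / 2) *\<^sub>R (\<Sum>j\<in>I. mat_expectation M (\<lambda>\<omega>. Y j \<omega> ** Y j \<omega>)))))"
  shows "integrable M F" "(\<integral>\<omega>. F \<omega> \<partial>M) \<le> B"
proof -
  have rv: "random_variable borel (Y j)" if "j \<in> I" for j
    using indep that by (auto simp: indep_vars_def)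
  \<comment> \<open>Passing through \<open>herm_part\<close> makes \<open>G\<close> Borel with
    self-adjoint values on all matrices; on the values of \<open>Y j\<close> it agrees with
    \<open>mat_fun g\<close>.\<close>
  define G where "G = (\<lambda>(_::nat) y. mat_fun g (herm_part y :: complex^'d^'d))"
  have cont: "continuous_on UNIV g"
  proof -
    have "1 + k * x + (k * x)\<^sup>2 / 2 \<noteq> 0" for x
      using half_le_exp_taylor2[of "k * x"] by linarith
    then show ?thesis unfolding g_def by (intro continuous_intros) auto
  qed
  have G: "G i \<in> borel_measurable borel" "self_adjoint (G i y)" for i y
    unfolding G_def by (auto intro!: borel_measurable_mat_fun cont self_adjoint_mat_fun self_adjoint_herm_part)
  have GY: "G j (Y j \<omega>) = mat_fun g (Y j \<omega>)" if "j \<in> I" "\<omega> \<in> space M" for j \<omega>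
    unfolding G_def using sa[OF that] by (simp add: herm_part_self_adjoint)
  \<comment> \<open>The moment bounds are demanded only for \<open>j \<in> I\<close>, so that a
    total function \<open>L\<close> can be chosen that is self-adjoint everywhere.\<close>
  define P where "P = (\<lambda>j L. self_adjoint L \<and> (j \<in> I \<longrightarrow>
    (\<forall>H. self_adjoint H \<longrightarrow> (\<integral>\<^sup>+\<omega>. ennreal (Re (trace (mat_fun exp (H + mat_fun g (Y j \<omega>))))) \<partial>M)
        \<le> ennreal (Re (trace (mat_fun exp (H + L))))) \<and>
    (\<forall>x. x \<bullet> (L *v x) \<le> x \<bullet> ((k *\<^sub>R mat_expectation M (Y j) + (k\<^sup>2 / 2) *\<^sub>R mat_expectation M (\<lambda>\<omega>. Y j \<omega> ** Y j \<omega>)) *v x))))"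
  have "\<exists>L. P j L" for j
  proof (cases "j \<in> I")
    case True
    show ?thesis
      using nn_integral_trace_exp_log_le[OF rv[OF True] sa[OF True] sq[OF True], of k] True unfolding P_def g_def by simp
  qed (use self_adjoint_0 in \<open>auto simp: P_def\<close>)
  then obtain L where P: "\<And>j. P j (L j)"
    by metis
  have L: "self_adjoint (L j)" for j
    using P[of j] by (simp add: P_def)
  have L1: "(\<integral>\<^sup>+\<omega>. ennreal (Re (trace (mat_fun exp (H + mat_fun g (Y j \<omega>))))) \<partial>M)
      \<le> ennreal (Re (trace (mat_fun exp (H + L j))))" if "j \<in> I" "self_adjoint H" for j H
    using P[of j] that by (simp add: P_def)
  have L2: "x \<bullet> (L j *v x)
      \<le> x \<bullet> ((k *\<^sub>R mat_expectation M (Y j) + (k\<^sup>2 / 2) *\<^sub>R mat_expectation M (\<lambda>\<omega>. Y j \<omega> ** Y j \<omega>)) *v x)"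
    if "j \<in> I" for j x
    using P[of j] that by (simp add: P_def)
  define H where "H = - k *\<^sub>R (\<Sum>j\<in>I. mat_expectation M (Y j))"
  have H: "self_adjoint H"
    unfolding H_def by (intro self_adjoint_scaleR self_adjoint_sum self_adjoint_mat_expectation sa)
  have saHG: "self_adjoint (H + (\<Sum>j\<in>I. G j (Y j \<omega>)))" for \<omega>
    by (intro self_adjoint_add self_adjoint_sum G H)
  have F: "F \<omega> = Re (trace (mat_fun exp (H + (\<Sum>j\<in>I. G j (Y j \<omega>)))))" if "\<omega> \<in> space M" for \<omega>
    unfolding F_def H_def using GY that by (simp add: sum_subtractf scaleR_sum_right sum_negf)
  have F0: "0 \<le> F \<omega>" if "\<omega> \<in> space M" for \<omega>
    unfolding F[OF that] by (rule trace_exp_nonneg[OF saHG])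
  have measF: "F \<in> borel_measurable M"
  proof -
    have "(\<lambda>\<omega>. H + (\<Sum>j\<in>I. G j (Y j \<omega>))) \<in> borel_measurable M"
      by (intro borel_measurable_add borel_measurable_sum borel_measurable_const measurable_compose[OF rv G(1)])
    from measurable_compose[OF this borel_measurable_trace_exp]
    have "(\<lambda>\<omega>. Re (trace (mat_fun exp (H + (\<Sum>j\<in>I. G j (Y j \<omega>)))))) \<in> borel_measurable M"
      unfolding herm_part_self_adjoint[OF saHG] .
    then show ?thesis using F by (simp cong: measurable_cong)
  qed
  have "(\<integral>\<^sup>+\<omega>. ennreal (F \<omega>) \<partial>M) = (\<integral>\<^sup>+\<omega>. ennreal (Re (trace (mat_fun exp (H + (\<Sum>j\<in>I. G j (Y j \<omega>)))))) \<partial>M)"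
    by (intro nn_integral_cong) (simp add: F)
  also have "\<dots> \<le> ennreal (Re (trace (mat_fun exp (H + (\<Sum>j\<in>I. L j)))))"
  proof (rule nn_integral_trace_exp_indep[OF indep I G L _ H])
    fix i and K :: "complex^'d^'d" assume i: "i \<in> I" "self_adjoint K"
    have "(\<integral>\<^sup>+\<omega>. ennreal (Re (trace (mat_fun exp (K + G i (Y i \<omega>))))) \<partial>M) = (\<integral>\<^sup>+\<omega>. ennreal (Re (trace (mat_fun exp (K + mat_fun g (Y i \<omega>))))) \<partial>M)"
      using GY i by (intro nn_integral_cong) simp
    then show "(\<integral>\<^sup>+\<omega>. ennreal (Re (trace (mat_fun exp (K + G i (Y i \<omega>))))) \<partial>M) \<le> ennreal (Re (trace (mat_fun exp (K + L i))))"
      using L1[OF i] by simp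
  qed
  also have "\<dots> \<le> ennreal B"
    unfolding B_def
  proof (intro ennreal_leI trace_exp_mono)
    show "self_adjoint (H + (\<Sum>j\<in>I. L j))"
      by (intro self_adjoint_add self_adjoint_sum L H)
    have "self_adjoint (Y j \<omega> ** Y j \<omega>)" if "j \<in> I" "\<omega> \<in> space M" for j \<omega>
      using sa[OF that] by (simp add: self_adjoint_def adjoint_mat_mult)
    then show "self_adjoint ((k\<^sup>2 / 2) *\<^sub>R (\<Sum>j\<in>I. mat_expectation M (\<lambda>\<omega>. Y j \<omega> ** Y j \<omega>)))"
      by (intro self_adjoint_scaleR self_adjoint_sum self_adjoint_mat_expectation)
    fix x :: "complex^'d"
    let ?q = "\<lambda>A::complex^'d^'d. x \<bullet> (A *v x)"
    have q: "?q (sum A I) = (\<Sum>j\<in>I. ?q (A j))" for A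
      by (rule bounded_linear.linear[OF bounded_linear_quadratic_form, THEN linear_sum])
    have "?q (H + (\<Sum>j\<in>I. L j)) = (\<Sum>j\<in>I. ?q (L j)) + ?q H"
      by (simp add: matrix_vector_mult_add_rdistrib inner_add_right q)
    also have "\<dots> \<le> (\<Sum>j\<in>I. ?q (k *\<^sub>R mat_expectation M (Y j) + (k\<^sup>2 / 2) *\<^sub>R mat_expectation M (\<lambda>\<omega>. Y j \<omega> ** Y j \<omega>))) + ?q H"
      by (intro add_right_mono sum_mono L2)
    also have "\<dots> = ?q ((\<Sum>j\<in>I. k *\<^sub>R mat_expectation M (Y j) + (k\<^sup>2 / 2) *\<^sub>R mat_expectation M (\<lambda>\<omega>. Y j \<omega> ** Y j \<omega>)) + H)"
      by (simp only: matrix_vector_mult_add_rdistrib inner_add_right q)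
    also have "\<dots> = ?q ((k\<^sup>2 / 2) *\<^sub>R (\<Sum>j\<in>I. mat_expectation M (\<lambda>\<omega>. Y j \<omega> ** Y j \<omega>)))"
      by (simp add: H_def sum.distrib scaleR_sum_right sum_negf)
    finally show "?q (H + (\<Sum>j\<in>I. L j)) \<le> \<dots>" .
  qed
  finally have le: "(\<integral>\<^sup>+\<omega>. ennreal (F \<omega>) \<partial>M) \<le> ennreal B" .
  have AE: "AE \<omega> in M. 0 \<le> F \<omega>"
    using F0 by (intro AE_I2)
  show int: "integrable M F"
    using le by (intro integrableI_nonneg measF AE) (rule le_less_trans, auto)
  have "0 \<le> B"
    unfolding B_def using sa
    by (intro trace_exp_nonneg self_adjoint_scaleR self_adjoint_sum self_adjoint_mat_expectation) (auto simp: self_adjoint_def adjoint_mat_mult)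
  then show "(\<integral>\<omega>. F \<omega> \<partial>M) \<le> B"
    using le nn_integral_eq_integral[OF int AE] by simp
qed

section \<open>The tail bound\<close>

text \<open>If \<open>2 * (1 + 1 / s) * exp c * exp (- s)\<close> is at least one, so is the claimed
  bound, as \<open>D \<ge> 1\<close>. Otherwise put \<open>q = exp (- s)\<close>,
  \<open>E = exp c\<close> and \<open>w = 1 + 1 / s\<close>. Then
  \<open>cosh s - 1 = (1 - q)\<^sup>2 / (2 * q)\<close>, and \<open>2 * w * E * q < 1\<close> with
  \<open>w \<ge> 1\<close> gives \<open>E - 1 \<le> w * E * (1 - q)\<^sup>2\<close>; the square
  cancels.\<close>

lemma exp_tail_bound:
  fixes p D c s :: real
  assumes p: "p \<le> 1" "p * (cosh s - 1) \<le> D * (exp c - 1)" and D: "1 \<le> D" and s: "0 < s"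
  shows "p \<le> 2 * D * (1 + 1 / s) * exp (- s + c)"
proof (cases "2 * (1 + 1 / s) * exp c * exp (- s) < 1")
  case False
  have "1 * (2 * (1 + 1 / s) * exp c * exp (- s)) \<le> D * (2 * (1 + 1 / s) * exp c * exp (- s))"
    using D s by (intro mult_right_mono) auto
  also have "\<dots> = 2 * D * (1 + 1 / s) * exp (- s + c)"
    unfolding exp_add by (simp only: mult_ac)
  finally show ?thesis
    using False p(1) by linarith
next
  case True
  define w q E where "w = 1 + 1 / s" and "q = exp (- s)" and "E = exp c"
  have q: "0 < q" "q < 1" and w: "1 \<le> w" and E: "0 < E"
    using s by (simp_all add: w_def q_def E_def)
  have exps: "exp s = 1 / q"
    by (simp add: q_def exp_minus field_simps)
  have cosh: "cosh s - 1 = (1 - q)\<^sup>2 / (2 * q)"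
    using q unfolding cosh_field_def exps q_def[symmetric] by (simp add: power2_eq_square field_simps)
  have "2 * w * E * q < 1"
    using True by (simp add: w_def q_def E_def)
  moreover have "1 * E \<le> w * E" "0 \<le> w * E * q\<^sup>2"
    using w E by (auto intro!: mult_right_mono)
  ultimately have "E - 1 \<le> w * E * (1 - q)\<^sup>2"
    by (simp add: power2_diff algebra_simps)
  then have "D * (E - 1) \<le> D * (w * E * (1 - q)\<^sup>2)"
    using D by (intro mult_left_mono) auto
  with p(2) have "p * ((1 - q)\<^sup>2 / (2 * q)) \<le> D * (w * E * (1 - q)\<^sup>2)"
    unfolding cosh E_def[symmetric] by linarith
  then have "p * (1 - q)\<^sup>2 \<le> (2 * q * D * w * E) * (1 - q)\<^sup>2"
    using q by (simp add: field_simps)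
  then have "p \<le> 2 * q * D * w * E"
    using q by (simp add: mult_le_cancel_right)
  then show ?thesis
    unfolding exp_add w_def q_def E_def by (simp only: mult_ac)
qed

text \<open>The chord of the convex exponential between \<open>0\<close> and \<open>c\<close>. With
  \<open>x = \<nu> i / \<kappa>\<close> and summed over \<open>i\<close>, it brings in the ratio of
  trace to norm, the effective dimension.\<close>

lemma exp_chord: "0 \<le> x \<Longrightarrow> x \<le> 1 \<Longrightarrow> exp (x * c) \<le> 1 + x * (exp c - 1)" for x c :: real
  using convex_onD[OF exp_convex, of x 0 c] by (simp add: algebra_simps)

theorem theorem3p2:
  fixes M :: "'a measure" and Y :: "nat \<Rightarrow> 'a \<Rightarrow> complex^'d^'d"
    and \<psi> :: "real \<Rightarrow> real" and n :: nat and \<sigma>2 \<theta> t :: real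
  assumes "prob_space M"
    and "mono \<psi>"
    and "\<And>x. - ln (1 - x + x\<^sup>2 / 2) \<le> \<psi> x"
    and "\<And>x. \<psi> x \<le> ln (1 + x + x\<^sup>2 / 2)"
    and "\<And>j. j \<in> {1..n} \<Longrightarrow> Y j \<in> borel_measurable M"
    and "prob_space.indep_vars M (\<lambda>_. borel) Y {1..n}"
    and "\<And>j \<omega>. j \<in> {1..n} \<Longrightarrow> \<omega> \<in> space M \<Longrightarrow> self_adjoint (Y j \<omega>)"
    and "\<And>j i k. j \<in> {1..n} \<Longrightarrow> integrable M (\<lambda>\<omega>. (cmod (Y j \<omega> $ i $ k))\<^sup>2)"
    and "(\<Sum>j\<in>{1..n}. mat_expectation M (\<lambda>\<omega>. Y j \<omega> ** Y j \<omega>)) \<noteq> 0"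
    and "\<sigma>2 \<ge> op_norm (\<Sum>j\<in>{1..n}. mat_expectation M (\<lambda>\<omega>. Y j \<omega> ** Y j \<omega>))"
    and "\<theta> > 0" and "t > 0"
  shows "measure M {\<omega> \<in> space M.
            op_norm (\<Sum>j\<in>{1..n}. (1 / \<theta>) *\<^sub>R mat_fun \<psi> (\<theta> *\<^sub>R Y j \<omega>) - mat_expectation M (Y j))
              \<ge> t * sqrt (real n)}
         \<le> 2 * (Re (trace (\<Sum>j\<in>{1..n}. mat_expectation M (\<lambda>\<omega>. Y j \<omega> ** Y j \<omega>)))
                 / op_norm (\<Sum>j\<in>{1..n}. mat_expectation M (\<lambda>\<omega>. Y j \<omega> ** Y j \<omega>)))
             * (1 + 1 / (\<theta> * t * sqrt (real n)))
             * exp (- \<theta> * t * sqrt (real n) + \<theta>\<^sup>2 * \<sigma>2 / 2)"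
proof -
  interpret prob_space M by fact
  note psi_lower = assms(3) and psi_upper = assms(4) and meas = assms(5) and indep = assms(6)
    and sa = assms(7) and sq = assms(8) and theta = assms(11)
  let ?I = "{1..n}"
  define V where "V = (\<Sum>j\<in>?I. mat_expectation M (\<lambda>\<omega>. Y j \<omega> ** Y j \<omega>))"
  define \<kappa> where "\<kappa> = op_norm V"
  define s where "s = \<theta> * t * sqrt (real n)"
  \<comment> \<open>The exponent first uses the norm \<open>\<kappa>\<close> itself, which scales
    the eigenvalues of \<open>V\<close> into \<open>[0, 1]\<close>; it is enlarged to
    \<open>\<sigma>2\<close> at the very end.\<close>
  define c where "c = \<theta>\<^sup>2 * \<kappa> / 2"
  define D where "D = Re (trace V) / \<kappa>"
  define S where "S = (\<lambda>\<omega>. \<Sum>j\<in>?I. (1 / \<theta>) *\<^sub>R mat_fun \<psi> (\<theta> *\<^sub>R Y j \<omega>) - mat_expectation M (Y j))"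
  define Ev where "Ev = {\<omega> \<in> space M. op_norm (S \<omega>) \<ge> t * sqrt (real n)}"
  have "V \<noteq> 0"
    using assms(9) by (simp add: V_def)
  then have "n \<noteq> 0"
    by (intro notI) (simp add: V_def)
  then have s: "0 < s" and I: "?I \<noteq> {}"
    using theta assms(12) by (auto simp: s_def)
  have saYY: "self_adjoint (Y j \<omega> ** Y j \<omega>)" if "j \<in> ?I" "\<omega> \<in> space M" for j \<omega>
    using sa[OF that] by (simp add: self_adjoint_def adjoint_mat_mult)
  have saE: "self_adjoint (mat_expectation M (Y j))" if "j \<in> ?I" for j
    by (intro self_adjoint_mat_expectation sa that)
  have "self_adjoint V"
    unfolding V_def by (intro self_adjoint_sum self_adjoint_mat_expectation saYY)
  then obtain W \<nu> where W: "unitary_mat W" and VW: "V = conj_diag W \<nu>"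
    using spectral_theorem by blast
  \<comment> \<open>The quadratic form of \<open>E Y\<^sub>j\<^sup>2\<close> at a vector
    \<open>w\<close> is the expectation of the squared norm of \<open>Y\<^sub>j w\<close>.\<close>
  have nu0: "0 \<le> \<nu> i" for i
  proof -
    let ?w = "column i W"
    have "?w \<bullet> (mat_expectation M (\<lambda>\<omega>. Y j \<omega> ** Y j \<omega>) *v ?w) \<ge> 0" if j: "j \<in> ?I" for j
    proof -
      note int = integrable_square_integrable_matrix(2)[OF meas[OF j] sq[OF j]]
      have "?w \<bullet> ((Y j \<omega> ** Y j \<omega>) *v ?w) = (norm (Y j \<omega> *v ?w))\<^sup>2" if "\<omega> \<in> space M" for \<omega>
        unfolding matrix_vector_mul_assoc[symmetric] inner_self_adjoint[OF sa[OF j that]] power2_norm_eq_inner ..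
      then have "(\<integral>\<omega>. ?w \<bullet> ((Y j \<omega> ** Y j \<omega>) *v ?w) \<partial>M) \<ge> 0"
        by (intro integral_nonneg_AE AE_I2) simp
      also have "(\<integral>\<omega>. ?w \<bullet> ((Y j \<omega> ** Y j \<omega>) *v ?w) \<partial>M) = ?w \<bullet> (mat_expectation M (\<lambda>\<omega>. Y j \<omega> ** Y j \<omega>) *v ?w)"
        unfolding mat_expectation_eq_integral[OF int]
        by (rule integral_bounded_linear[OF bounded_linear_quadratic_form int])
      finally show ?thesis .
    qed
    then have "0 \<le> ?w \<bullet> (V *v ?w)"
      unfolding V_def linear_sum[OF bounded_linear.linear[OF bounded_linear_quadratic_form]] by (rule sum_nonneg)
    also have "\<dots> = \<nu> i"
      using norm_column_unitary[OF W, of i] by (simp add: VW conj_diag_column[OF W] norm_eq_1)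
    finally show ?thesis .
  qed
  have nu_le: "\<nu> i \<le> \<kappa>" for i
    using le_op_norm_conj_diag[OF W, of \<nu> i] unfolding \<kappa>_def VW by linarith
  have kappa: "0 < \<kappa>"
  proof (rule ccontr)
    assume "\<not> 0 < \<kappa>"
    then have "\<nu> i = 0" for i
      using nu0[of i] nu_le[of i] by linarith
    then have "V = 0"
      unfolding VW vec_eq_iff conj_diag_nth by simp
    with \<open>V \<noteq> 0\<close> show False ..
  qed
  have trV: "Re (trace V) = (\<Sum>i\<in>UNIV. \<nu> i)"
    by (simp add: VW trace_conj_diag[OF W])
  have D: "1 \<le> D"
  proof -
    obtain i where "\<kappa> \<le> \<bar>\<nu> i\<bar>"
      using ex_eigenvalue_ge_op_norm[OF W, of \<kappa> \<nu>] by (auto simp: \<kappa>_def VW)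
    also have "\<dots> \<le> (\<Sum>i\<in>UNIV. \<nu> i)"
      using nu0 by (simp add: member_le_sum)
    finally show ?thesis
      using kappa by (simp add: D_def trV)
  qed
  have B: "Re (trace (mat_fun exp ((\<theta>\<^sup>2 / 2) *\<^sub>R V))) \<le> real CARD('d) + D * (exp c - 1)"
  proof -
    have "Re (trace (mat_fun exp ((\<theta>\<^sup>2 / 2) *\<^sub>R V))) = (\<Sum>i\<in>UNIV. exp (\<nu> i / \<kappa> * c))"
      using kappa by (simp add: VW conj_diag_scaleR mat_fun_conj_diag[OF W] trace_conj_diag[OF W] c_def mult_ac)
    also have "\<dots> \<le> (\<Sum>i\<in>UNIV. 1 + \<nu> i / \<kappa> * (exp c - 1))"
      using kappa nu0 nu_le by (intro sum_mono exp_chord) auto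
    also have "\<dots> = real CARD('d) + D * (exp c - 1)"
      by (simp add: sum.distrib D_def trV sum_distrib_right sum_divide_distrib)
    finally show ?thesis .
  qed
  define F where "F = (\<lambda>k \<omega>. Re (trace (mat_fun exp (\<Sum>j\<in>?I. mat_fun (\<lambda>x. ln (1 + k * x + (k * x)\<^sup>2 / 2)) (Y j \<omega>)
      - k *\<^sub>R mat_expectation M (Y j)))))"
  have F: "integrable M (F k)" "(\<integral>\<omega>. F k \<omega> \<partial>M) \<le> real CARD('d) + D * (exp c - 1)" if "k\<^sup>2 = \<theta>\<^sup>2" for k
    using integral_trace_exp_sum_log_le[OF indep _ I sa sq, of k] B that
    by (simp_all add: F_def V_def)
  \<comment> \<open>Markov's inequality in pointwise form. On \<open>Ev\<close> some eigenvalue of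
    \<open>Z\<close> has modulus at least \<open>s\<close>, and the terms
    \<open>2 * cosh (l i) - 2\<close> are nonnegative, so one of them bounds their sum
    \<open>tr (exp Z) + tr (exp (- Z)) - 2 d\<close> from below.\<close>
  have key: "(2 * cosh s - 2) * indicator Ev \<omega> \<le> F \<theta> \<omega> + F (- \<theta>) \<omega> - 2 * real CARD('d)"
    if \<omega>: "\<omega> \<in> space M" for \<omega>
  proof -
    define Z where "Z = \<theta> *\<^sub>R S \<omega>"
    have Z: "Z = (\<Sum>j\<in>?I. mat_fun \<psi> (\<theta> *\<^sub>R Y j \<omega>) - \<theta> *\<^sub>R mat_expectation M (Y j))"
      using theta by (simp add: Z_def S_def scaleR_sum_right scaleR_diff_right)
    have saZ: "self_adjoint Z"
      unfolding Z by (intro self_adjoint_sum self_adjoint_diff self_adjoint_mat_fun self_adjoint_scaleR sa saE \<omega>)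
    then obtain U l where U: "unitary_mat U" and ZU: "Z = conj_diag U l"
      using spectral_theorem by blast
    \<comment> \<open>Used with \<open>\<epsilon> = 1\<close> and \<open>\<epsilon> = - 1\<close>,
      one for each tail. Only quadratic forms are compared; \<open>trace_exp_mono\<close> carries
      the order over to the traces.\<close>
    have le: "Re (trace (mat_fun exp (\<epsilon> *\<^sub>R Z))) \<le> F (\<epsilon> * \<theta>) \<omega>"
      if psi: "\<And>x. \<epsilon> * \<psi> (\<theta> * x) \<le> ln (1 + \<epsilon> * \<theta> * x + (\<epsilon> * \<theta> * x)\<^sup>2 / 2)" for \<epsilon>
      unfolding F_def
    proof (rule trace_exp_mono)
      let ?g = "\<lambda>x. ln (1 + \<epsilon> * \<theta> * x + (\<epsilon> * \<theta> * x)\<^sup>2 / 2)"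
      show "self_adjoint (\<epsilon> *\<^sub>R Z)"
        by (intro self_adjoint_scaleR saZ)
      show "self_adjoint (\<Sum>j\<in>?I. mat_fun ?g (Y j \<omega>) - (\<epsilon> * \<theta>) *\<^sub>R mat_expectation M (Y j))"
        by (intro self_adjoint_sum self_adjoint_diff self_adjoint_mat_fun self_adjoint_scaleR sa saE \<omega>)
      fix x :: "complex^'d"
      note q_sum = linear_sum[OF bounded_linear.linear[OF bounded_linear_quadratic_form]]
      have "x \<bullet> ((\<epsilon> *\<^sub>R mat_fun \<psi> (\<theta> *\<^sub>R Y j \<omega>)) *v x) \<le> x \<bullet> (mat_fun ?g (Y j \<omega>) *v x)"
        if j: "j \<in> ?I" for j
      proof -
        obtain P p where P: "unitary_mat P" "Y j \<omega> = conj_diag P p"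
          using spectral_theorem[OF sa[OF j \<omega>]] .
        have "\<epsilon> *\<^sub>R mat_fun \<psi> (\<theta> *\<^sub>R Y j \<omega>) = mat_fun (\<lambda>x. \<epsilon> * \<psi> (\<theta> * x)) (Y j \<omega>)"
          by (simp add: P(2) conj_diag_scaleR mat_fun_conj_diag[OF P(1)] comp_def)
        then show ?thesis
          using inner_mat_fun_mono[OF sa[OF j \<omega>] psi] by simp
      qed
      then have "x \<bullet> ((\<epsilon> *\<^sub>R mat_fun \<psi> (\<theta> *\<^sub>R Y j \<omega>) - (\<epsilon> * \<theta>) *\<^sub>R mat_expectation M (Y j)) *v x)
          \<le> x \<bullet> ((mat_fun ?g (Y j \<omega>) - (\<epsilon> * \<theta>) *\<^sub>R mat_expectation M (Y j)) *v x)" if "j \<in> ?I" for j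
        using that by (simp add: matrix_vector_mult_diff_rdistrib inner_diff_right)
      then show "x \<bullet> ((\<epsilon> *\<^sub>R Z) *v x)
          \<le> x \<bullet> ((\<Sum>j\<in>?I. mat_fun ?g (Y j \<omega>) - (\<epsilon> * \<theta>) *\<^sub>R mat_expectation M (Y j)) *v x)"
        unfolding Z scaleR_sum_right scaleR_diff_right scaleR_scaleR q_sum by (rule sum_mono)
    qed
    have "(\<Sum>i\<in>UNIV. exp (l i)) \<le> F \<theta> \<omega>"
      using le[of 1] psi_upper[of "\<theta> * _"]
      by (simp add: ZU mat_fun_conj_diag[OF U] trace_conj_diag[OF U])
    moreover have "(\<Sum>i\<in>UNIV. exp (- l i)) \<le> F (- \<theta>) \<omega>"
    proof -
      \<comment> \<open>The lower bound on \<open>\<psi>\<close>, negated, is what \<open>le\<close>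
        requires for \<open>\<epsilon> = - 1\<close>.\<close>
      have "- \<psi> (\<theta> * x) \<le> ln (1 - \<theta> * x + (\<theta> * x)\<^sup>2 / 2)" for x
        using psi_lower[of "\<theta> * x"] by linarith
      then have "Re (trace (mat_fun exp (- 1 *\<^sub>R Z))) \<le> F (- 1 * \<theta>) \<omega>"
        by (intro le) simp
      then show ?thesis
        unfolding ZU conj_diag_scaleR mat_fun_conj_diag[OF U] trace_conj_diag[OF U] by simp
    qed
    moreover have "(\<Sum>i\<in>UNIV. 2 * cosh (l i) - 2) = (\<Sum>i\<in>UNIV. exp (l i)) + (\<Sum>i\<in>UNIV. exp (- l i)) - 2 * real CARD('d)"
    proof -
      have "2 * cosh x - 2 = exp x + exp (- x) - 2" for x :: real
        by (simp add: cosh_field_def)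
      then show ?thesis by (simp add: sum.distrib sum_subtractf)
    qed
    moreover have "(2 * cosh s - 2) * indicator Ev \<omega> \<le> (\<Sum>i\<in>UNIV. 2 * cosh (l i) - 2)"
    proof (cases "\<omega> \<in> Ev")
      case True
      have "S \<omega> = conj_diag U (\<lambda>i. l i / \<theta>)"
      proof -
        have "S \<omega> = (1 / \<theta>) *\<^sub>R Z"
          using theta by (simp add: Z_def)
        then show ?thesis by (simp add: ZU conj_diag_scaleR)
      qed
      then obtain i where "t * sqrt (real n) \<le> \<bar>l i / \<theta>\<bar>"
        using True ex_eigenvalue_ge_op_norm[OF U, of "t * sqrt (real n)" "\<lambda>i. l i / \<theta>"] by (auto simp: Ev_def)
      then have "s \<le> \<bar>l i\<bar>"
        using theta by (simp add: s_def field_simps)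
      then have "cosh s \<le> cosh \<bar>l i\<bar>"
        using s by (subst cosh_real_nonneg_le_iff) auto
      then have "2 * cosh s - 2 \<le> 2 * cosh (l i) - 2"
        by (simp add: cosh_real_abs)
      also have "\<dots> \<le> (\<Sum>i\<in>UNIV. 2 * cosh (l i) - 2)"
        by (rule member_le_sum) (auto simp: cosh_real_ge_1)
      finally show ?thesis using True by simp
    qed (simp add: sum_nonneg cosh_real_ge_1)
    ultimately show ?thesis by linarith
  qed
  have "measure M Ev \<le> 2 * D * (1 + 1 / s) * exp (- s + c)"
  proof (rule exp_tail_bound[OF _ _ D s])
    show "measure M Ev * (cosh s - 1) \<le> D * (exp c - 1)"
    proof (cases "Ev \<in> sets M")
      case True
      have "(2 * cosh s - 2) * measure M Ev = (\<integral>\<omega>. (2 * cosh s - 2) * indicator Ev \<omega> \<partial>M)"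
        using True by (simp add: Ev_def)
      also have "\<dots> \<le> (\<integral>\<omega>. F \<theta> \<omega> + F (- \<theta>) \<omega> - 2 * real CARD('d) \<partial>M)"
        using True by (intro integral_mono key Bochner_Integration.integrable_diff Bochner_Integration.integrable_add F integrable_mult_right) 
         (auto simp: emeasure_eq_measure)
      also have "\<dots> = (\<integral>\<omega>. F \<theta> \<omega> \<partial>M) + (\<integral>\<omega>. F (- \<theta>) \<omega> \<partial>M) - 2 * real CARD('d)"
        using F by (simp add: prob_space)
      \<comment> \<open>The term \<open>CARD('d)\<close> in each of the two bounds cancels against
        \<open>2 * CARD('d)\<close>, and only the effective dimension \<open>D\<close>
        survives.\<close>
      also have "\<dots> \<le> 2 * (D * (exp c - 1))"
        using F(2)[of \<theta>] F(2)[of "- \<theta>"] by simp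
      finally show ?thesis by (simp add: algebra_simps)
    next
      case False
      \<comment> \<open>The left-hand side is zero for a non-measurable event, and
        \<open>c \<ge> 0\<close> makes the right-hand side nonnegative.\<close>
      have "0 \<le> c"
        using kappa by (simp add: c_def)
      with False D show ?thesis by (simp add: measure_notin_sets)
    qed
  qed simp
  also have "\<dots> \<le> 2 * D * (1 + 1 / s) * exp (- s + \<theta>\<^sup>2 * \<sigma>2 / 2)"
    using D s assms(10) unfolding c_def \<kappa>_def V_def
    by (intro mult_left_mono) (auto intro!: mult_left_mono)
  finally show ?thesis
    by (simp add: Ev_def S_def D_def \<kappa>_def V_def s_def)
qed

end
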